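(* Let $\mathcal{B}$ be a unital $C^*$-algebra of real rank zero, $\mathcal{M}$ a unital $C^*$-algebra, and $\pi:\mathcal{B}\to\mathcal{M}$ a unital surjective $\ast$-homomorphism. Let $\{p_1,p_2,\ldots\}\subseteq\mathcal{M}$ be a (countable) commuting family of projections. Then there is a unital $\ast$-cross section $\gamma$ for $\pi$ on $C^*(p_1,p_2,\ldots)$. Moreover, if $\gamma_n: C^*(p_1,\ldots,p_n)\to\mathcal{B}$ is a unital $\ast$-cross section for $\pi$ on $C^*(p_1,\ldots,p_n)$, then there is a unital $\ast$-cross section $\gamma_{n+1}$ for $\pi$ on $C^*(p_1,\ldots,p_{n+1})$ whose restriction to $C^*(p_1,\ldots,p_n)$ is $\gamma_n$.
   Context: A $C^*$-algebra has real rank zero if every self-adjoint element is a norm limit of self-adjoint elements with finite spectrum. For a surjective $\ast$-homomorphism $\pi:\mathcal{B}\to\mathcal{M}$ and a $C^*$-subalgebra $\mathcal{S}\subseteq\mathcal{M}$, a $\ast$-cross section for $\pi$ on $\mathcal{S}$ is a $\ast$-homomorphism $\gamma:\mathcal{S}\to\mathcal{B}$ such that $\pi\circ\gamma$ is the identity on $\mathcal{S}$; it is unital if $\gamma(1)=1$. *)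

theory Defs
  imports "HOL-Analysis.Analysis"
begin

class unital_cstar_algebra = real_normed_algebra_1 + banach +
  fixes scaleC :: "complex \<Rightarrow> 'a \<Rightarrow> 'a"
    and cstar :: "'a \<Rightarrow> 'a"
  assumes scaleC_add_left: "scaleC (a + b) x = scaleC a x + scaleC b x"
    and scaleC_add_right: "scaleC a (x + y) = scaleC a x + scaleC a y"
    and scaleC_scaleC: "scaleC a (scaleC b x) = scaleC (a * b) x"
    and scaleC_one: "scaleC 1 x = x"
    and scaleC_of_real: "scaleC (complex_of_real r) x = scaleR r x"
    and norm_scaleC: "norm (scaleC a x) = cmod a * norm x"
    and scaleC_mult_left: "scaleC a x * y = scaleC a (x * y)"
    and scaleC_mult_right: "x * scaleC a y = scaleC a (x * y)"
    and cstar_add: "cstar (x + y) = cstar x + cstar y"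
    and cstar_scaleC: "cstar (scaleC a x) = scaleC (cnj a) (cstar x)"
    and cstar_mult: "cstar (x * y) = cstar y * cstar x"
    and cstar_cstar: "cstar (cstar x) = x"
    and cstar_identity: "norm (cstar x * x) = norm x ^ 2"

definition is_invertible :: "'a::unital_cstar_algebra \<Rightarrow> bool" where
  "is_invertible x \<longleftrightarrow> (\<exists>y. x * y = 1 \<and> y * x = 1)"

definition cspectrum :: "'a::unital_cstar_algebra \<Rightarrow> complex set" where
  "cspectrum x = {c. \<not> is_invertible (x - scaleC c 1)}"

definition self_adjoint :: "'a::unital_cstar_algebra \<Rightarrow> bool" where
  "self_adjoint x \<longleftrightarrow> cstar x = x"

definition is_projection :: "'a::unital_cstar_algebra \<Rightarrow> bool" where
  "is_projection p \<longleftrightarrow> p * p = p \<and> cstar p = p"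

definition real_rank_zero :: "'a::unital_cstar_algebra itself \<Rightarrow> bool" where
  "real_rank_zero _ \<longleftrightarrow>
     (\<forall>x::'a. self_adjoint x \<longrightarrow>
        x \<in> closure {y. self_adjoint y \<and> finite (cspectrum y)})"

definition is_unital_cstar_subalgebra :: "'a::unital_cstar_algebra set \<Rightarrow> bool" where
  "is_unital_cstar_subalgebra S \<longleftrightarrow>
     1 \<in> S \<and> (\<forall>x\<in>S. \<forall>y\<in>S. x + y \<in> S \<and> x * y \<in> S) \<and>
     (\<forall>c. \<forall>x\<in>S. scaleC c x \<in> S) \<and> (\<forall>x\<in>S. cstar x \<in> S) \<and> closed S"

definition cstar_generated :: "'a::unital_cstar_algebra set \<Rightarrow> 'a set" where
  "cstar_generated G = \<Inter> {S. is_unital_cstar_subalgebra S \<and> G \<subseteq> S}"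

definition star_hom :: "('a::unital_cstar_algebra \<Rightarrow> 'b::unital_cstar_algebra) \<Rightarrow> bool" where
  "star_hom f \<longleftrightarrow>
     (\<forall>x y. f (x + y) = f x + f y) \<and> (\<forall>c x. f (scaleC c x) = scaleC c (f x)) \<and>
     (\<forall>x y. f (x * y) = f x * f y) \<and> (\<forall>x. f (cstar x) = cstar (f x))"

definition star_hom_on :: "'a::unital_cstar_algebra set \<Rightarrow> ('a \<Rightarrow> 'b::unital_cstar_algebra) \<Rightarrow> bool" where
  "star_hom_on S f \<longleftrightarrow>
     (\<forall>x\<in>S. \<forall>y\<in>S. f (x + y) = f x + f y \<and> f (x * y) = f x * f y) \<and>
     (\<forall>c. \<forall>x\<in>S. f (scaleC c x) = scaleC c (f x)) \<and>
     (\<forall>x\<in>S. f (cstar x) = cstar (f x))"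

definition unital_star_cross_section ::
  "('b::unital_cstar_algebra \<Rightarrow> 'm::unital_cstar_algebra) \<Rightarrow> 'm set \<Rightarrow> ('m \<Rightarrow> 'b) \<Rightarrow> bool" where
  "unital_star_cross_section \<pi> S \<gamma> \<longleftrightarrow>
     star_hom_on S \<gamma> \<and> (\<forall>x\<in>S. \<pi> (\<gamma> x) = x) \<and> \<gamma> 1 = 1"

end

theory Submission
  imports Defs "HOL-Computational_Algebra.Fundamental_Theorem_Algebra"
begin

text \<open>
  Projections lift along \<open>\<pi>\<close>, even below a prescribed projection \<open>f\<close>. Given a self-adjoint lift \<open>x\<close> of \<open>q\<close>
  with \<open>f x = x\<close>, real rank zero yields a nearby self-adjoint \<open>y\<close> with finite spectrum. If \<open>E\<close> is
  the spectral projection of \<open>y\<close> for \<open>\<bar>s\<bar> > 1/2\<close>, then \<open>E x\<^sup>2 E\<close> is invertible in the corner of \<open>E\<close>,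
  and the range projection of \<open>x E\<close>, which is an algebraic expression in \<open>x\<close>, \<open>E\<close> and that inverse,
  lies below \<open>f\<close>; it maps onto \<open>q\<close> because \<open>(1 - E) x\<close> has norm less than \<open>1\<close>.

  Finitely many commuting projections generate the span of a finite partition of unity.
  Adjoining one more projection splits every member in two, and lifting one of the two halves
  below the lift of the member extends the cross section. All these cross sections are contractive, so
  the one on the increasing union extends by continuity.
\<close>

section \<open>Scalars, involution and invertibility\<close>

lemma bounded_bilinear_scaleC:
  "bounded_bilinear (scaleC :: complex \<Rightarrow> 'a::unital_cstar_algebra \<Rightarrow> 'a)"
proof
  fix r :: real and a :: complex and x :: 'a
  show "scaleC (r *\<^sub>R a) x = r *\<^sub>R scaleC a x"
    by (metis scaleC_scaleC scaleC_of_real scaleR_conv_of_real)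
  show "scaleC a (r *\<^sub>R x) = r *\<^sub>R scaleC a x"
    by (metis scaleC_scaleC scaleC_of_real mult.commute)
  show "\<exists>K. \<forall>a x. norm (scaleC a (x::'a)) \<le> norm a * norm x * K"
    by (rule exI[of _ 1]) (simp add: norm_scaleC)
qed (simp_all add: scaleC_add_left scaleC_add_right)

interpretation scaleC: bounded_bilinear "scaleC :: complex \<Rightarrow> 'a::unital_cstar_algebra \<Rightarrow> 'a"
  by (rule bounded_bilinear_scaleC)

lemmas scaleC_mult = scaleC_mult_left scaleC_mult_right

lemma scaleC_eq_0_iff [simp]:
  "scaleC c x = 0 \<longleftrightarrow> c = 0 \<or> x = (0::'a::unital_cstar_algebra)"
  by (metis norm_scaleC norm_eq_zero mult_eq_0_iff)

lemma scaleC_right_cancel: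
  "scaleC c x = scaleC d x \<Longrightarrow> x \<noteq> (0::'a::unital_cstar_algebra) \<Longrightarrow> c = d"
  by (metis scaleC.diff_left scaleC_eq_0_iff eq_iff_diff_eq_0)

lemma cstar_zero [simp]: "cstar (0::'a::unital_cstar_algebra) = 0"
  by (metis cstar_add add_cancel_right_right)

lemma cstar_one [simp]: "cstar (1::'a::unital_cstar_algebra) = 1"
  by (metis cstar_cstar cstar_mult mult.right_neutral)

lemma cstar_minus: "cstar (- x) = - cstar (x::'a::unital_cstar_algebra)"
  by (metis cstar_add cstar_zero add.right_inverse minus_unique)

lemma cstar_diff: "cstar (x - y) = cstar x - cstar (y::'a::unital_cstar_algebra)"
  by (metis cstar_add cstar_minus diff_conv_add_uminus)

lemma cstar_sum: "cstar (sum f I) = (\<Sum>i\<in>I. cstar (f i :: 'a::unital_cstar_algebra))"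
  by (induction I rule: infinite_finite_induct) (simp_all add: cstar_add)

text \<open>The C*-identity and submultiplicativity give \<open>norm y \<le> norm (cstar y)\<close>;
  taking \<open>y = cstar x\<close> supplies the reverse inequality.\<close>

lemma norm_cstar [simp]: "norm (cstar x) = norm (x::'a::unital_cstar_algebra)"
proof -
  have "norm y \<le> norm (cstar y)" for y :: 'a
  proof (cases "y = 0")
    case False
    have "norm y * norm y \<le> norm (cstar y) * norm y"
      using norm_mult_ineq[of "cstar y" y] by (simp add: cstar_identity power2_eq_square)
    then show ?thesis using False by simp
  qed simp
  from this[of x] this[of "cstar x"] show ?thesis by (simp add: cstar_cstar)
qed

lemma bounded_linear_cstar: "bounded_linear (cstar :: 'a::unital_cstar_algebra \<Rightarrow> 'a)"
proof
  fix r :: real and x :: 'a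
  show "cstar (r *\<^sub>R x) = r *\<^sub>R cstar x"
    by (metis cstar_scaleC scaleC_of_real complex_cnj_complex_of_real)
  show "\<exists>K. \<forall>x::'a. norm (cstar x) \<le> norm x * K"
    by (rule exI[of _ 1]) simp
qed (rule cstar_add)

lemma norm_projection_le: "is_projection p \<Longrightarrow> norm (p::'a::unital_cstar_algebra) \<le> 1"
  using cstar_identity[of p] unfolding is_projection_def
  by (metis norm_ge_zero power2_eq_square mult_cancel_right1 order_refl zero_le_one)

lemma is_invertible_one: "is_invertible 1"
  by (auto simp: is_invertible_def)

lemma is_invertible_mult:
  assumes "is_invertible x" "is_invertible y"
  shows "is_invertible (x * y)"
proof -
  obtain u v where u: "x * u = 1" "u * x = 1" and v: "y * v = 1" "v * y = 1"
    using assms by (auto simp: is_invertible_def)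
  have "x * y * (v * u) = x * (y * v) * u" "v * u * (x * y) = v * (u * x) * y"
    by (simp_all add: mult.assoc)
  with u v show ?thesis unfolding is_invertible_def by auto
qed

lemma is_invertible_scaleC:
  assumes "is_invertible x" "c \<noteq> 0"
  shows "is_invertible (scaleC c x)"
proof -
  obtain u where "x * u = 1" "u * x = 1" using assms by (auto simp: is_invertible_def)
  then have "scaleC c x * scaleC (1/c) u = 1" "scaleC (1/c) u * scaleC c x = 1"
    using assms(2) by (simp_all add: scaleC_mult scaleC_scaleC scaleC_one)
  then show ?thesis unfolding is_invertible_def by blast
qed

text \<open>The geometric series of \<open>a\<close> converges and is a two-sided inverse.\<close>

lemma is_invertible_one_minus:
  fixes a :: "'a::unital_cstar_algebra"
  assumes "norm a < 1"
  shows "is_invertible (1 - a)"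
proof -
  have s: "summable (\<lambda>n. a ^ n)"
    by (rule complete_algebra_summable_geometric[OF assms])
  define b where "b = (\<Sum>n. a ^ n)"
  have l: "a * b = (\<Sum>n. a ^ Suc n)" unfolding b_def by (simp add: suminf_mult[OF s])
  have r: "b * a = (\<Sum>n. a ^ Suc n)" unfolding b_def
    by (simp add: suminf_mult2[OF s] power_commutes)
  have "(\<Sum>n. a ^ Suc n) = b - 1"
    using suminf_split_head[OF s] by (simp add: b_def)
  with l r have "(1 - a) * b = 1" "b * (1 - a) = 1"
    by (simp_all add: algebra_simps)
  then show ?thesis unfolding is_invertible_def by blast
qed

lemma cspectrum_norm_le:
  assumes "\<mu> \<in> cspectrum x"
  shows "cmod \<mu> \<le> norm x"
proof (rule ccontr)
  assume "\<not> ?thesis"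
  then have lt: "norm x < cmod \<mu>" by simp
  then have nz: "\<mu> \<noteq> 0" by auto
  have "norm (scaleC (1/\<mu>) x) < 1" using lt nz by (simp add: norm_scaleC norm_divide field_simps)
  from is_invertible_scaleC[OF is_invertible_one_minus[OF this], of "- \<mu>"] nz
  have "is_invertible (x - scaleC \<mu> 1)"
    by (simp add: scaleC.diff_right scaleC.minus_left scaleC_scaleC scaleC_one)
  with assms show False by (simp add: cspectrum_def)
qed

section \<open>Spectra of self-adjoint elements\<close>

lemma self_adjoint_power: "self_adjoint z \<Longrightarrow> self_adjoint (z ^ n)"
  by (induction n) (simp_all add: self_adjoint_def cstar_mult power_commutes)

lemma norm_self_adjoint_square:
  "self_adjoint z \<Longrightarrow> norm (z * z) = norm z ^ 2"
  using cstar_identity[of z] by (simp add: self_adjoint_def)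

lemma norm_self_adjoint_power:
  assumes "self_adjoint z"
  shows "norm (z ^ (2 ^ k)) = norm z ^ (2 ^ k)"
proof (induction k)
  case (Suc k)
  have "z ^ (2 ^ Suc k) = z ^ (2 ^ k) * z ^ (2 ^ k)"
    by (simp add: power_add[symmetric] mult_2)
  then have "norm (z ^ (2 ^ Suc k)) = norm (z ^ (2 ^ k)) ^ 2"
    using norm_self_adjoint_square[OF self_adjoint_power[OF assms]] by simp
  also have "\<dots> = norm z ^ (2 ^ Suc k)"
    by (simp add: Suc power_mult[symmetric] mult.commute)
  finally show ?case .
qed simp

text \<open>If the resolvent existed on the closed unit disc, its averages over the \<open>2\<^sup>k\<close>-th roots of unity,
  which are the inverses of \<open>1 - \<zeta>\<^sup>N z\<^sup>N\<close> with \<open>N = 2\<^sup>k\<close>, would share one modulus of continuity.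
  Inside the disc they tend to \<open>1\<close>, so they are near \<open>1\<close> at \<open>\<zeta> = 1\<close>, although
  \<open>z\<^sup>N\<close> has norm \<open>1\<close>.\<close>

lemma resolvent_fails_on_unit_disc:
  fixes z :: "'a::unital_cstar_algebra"
  assumes sa: "self_adjoint z" and n1: "norm z = 1"
  shows "\<exists>\<zeta>. cmod \<zeta> \<le> 1 \<and> \<not> is_invertible (1 - scaleC \<zeta> z)"
proof (rule ccontr)
  assume "\<not> ?thesis"
  then have "\<forall>\<zeta>\<in>cball 0 1. \<exists>y. (1 - scaleC \<zeta> z) * y = 1 \<and> y * (1 - scaleC \<zeta> z) = 1"
    by (auto simp: is_invertible_def)
  from bchoice[OF this] obtain r where
    "\<forall>\<zeta>\<in>cball 0 1. (1 - scaleC \<zeta> z) * r \<zeta> = 1 \<and> r \<zeta> * (1 - scaleC \<zeta> z) = 1" ..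
  then have r: "(1 - scaleC \<zeta> z) * r \<zeta> = 1" "r \<zeta> * (1 - scaleC \<zeta> z) = 1"
    if "cmod \<zeta> \<le> 1" for \<zeta>
    using that by simp_all
  \<comment> \<open>The resolvent identity, which becomes a Lipschitz estimate once the norms of
    \<open>r\<close> are controlled near a point.\<close>
  have res: "norm (r \<zeta> - r \<mu>) \<le> cmod (\<zeta> - \<mu>) * norm (r \<zeta>) * norm (r \<mu>)"
    if "cmod \<zeta> \<le> 1" "cmod \<mu> \<le> 1" for \<zeta> \<mu>
  proof -
    have "r \<zeta> - r \<mu> = r \<zeta> * ((1 - scaleC \<mu> z) * r \<mu>) - (r \<zeta> * (1 - scaleC \<zeta> z)) * r \<mu>"
      using r that by simp
    also have "\<dots> = scaleC (\<zeta> - \<mu>) (r \<zeta> * z * r \<mu>)"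
      by (simp add: algebra_simps scaleC.diff_left scaleC_mult)
    finally have "norm (r \<zeta> - r \<mu>) = cmod (\<zeta> - \<mu>) * norm (r \<zeta> * z * r \<mu>)"
      by (simp add: norm_scaleC)
    moreover have "norm (r \<zeta> * z * r \<mu>) \<le> norm (r \<zeta>) * norm (r \<mu>)"
      using norm_mult_ineq[of "r \<zeta> * z" "r \<mu>"] norm_mult_ineq[of "r \<zeta>" z] n1
      by (metis mult.right_neutral mult_right_mono norm_ge_zero order_trans)
    ultimately show ?thesis by (simp add: mult_left_mono mult.assoc)
  qed
  have "continuous_on (cball 0 1) r"
    unfolding continuous_on_iff
  proof (intro ballI allI impI)
    fix \<mu> :: complex and e :: real
    assume mu: "\<mu> \<in> cball 0 1" and e: "0 < e"
    define M where "M = norm (r \<mu>) + 1"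
    have M: "M \<ge> 1" "norm (r \<mu>) \<le> M" by (auto simp: M_def)
    \<comment> \<open>The bound \<open>1 / (2 * M)\<close> lets the term \<open>(t * M) * D\<close>
      be absorbed into the left side, in place of an a priori bound on \<open>r \<zeta>\<close>; the
      other bound makes the remainder \<open>2 * t * M * M\<close> at most
      \<open>e / 2\<close>.\<close>
    define d where "d = min (1 / (2 * M)) (e / (4 * M * M))"
    have d: "d > 0" using M e by (simp add: d_def)
    show "\<exists>d>0. \<forall>\<zeta>\<in>cball 0 1. dist \<zeta> \<mu> < d \<longrightarrow> dist (r \<zeta>) (r \<mu>) < e"
    proof (rule exI[of _ d], intro conjI d ballI impI)
      fix \<zeta> :: complex
      assume la: "\<zeta> \<in> cball 0 1" and dl: "dist \<zeta> \<mu> < d"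
      define D where "D = norm (r \<zeta> - r \<mu>)"
      define t where "t = cmod (\<zeta> - \<mu>)"
      have t: "0 \<le> t" "t < d" using dl by (auto simp: t_def dist_norm)
      have "norm (r \<zeta>) \<le> M + D" unfolding D_def M_def
        using norm_triangle_sub[of "r \<zeta>" "r \<mu>"] by simp
      then have "norm (r \<zeta>) * norm (r \<mu>) \<le> (M + D) * M"
        using M by (intro mult_mono) (auto simp: D_def)
      moreover have "D \<le> t * (norm (r \<zeta>) * norm (r \<mu>))"
        using res[of \<zeta> \<mu>] la mu by (simp add: D_def t_def mult.assoc)
      ultimately have "D \<le> t * ((M + D) * M)"
        using t(1) by (meson mult_left_mono order_trans)
      also have "\<dots> = t * M * M + (t * M) * D" by (simp add: algebra_simps)
      also have "\<dots> \<le> t * M * M + 1/2 * D"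
      proof -
        have "t * M \<le> d * M" using t M by (intro mult_right_mono) auto
        also have "\<dots> \<le> 1 / (2 * M) * M" using M by (intro mult_right_mono) (auto simp: d_def)
        finally have "t * M \<le> 1/2" using M by simp
        then show ?thesis by (intro add_left_mono mult_right_mono) (auto simp: D_def)
      qed
      finally have "D \<le> 2 * t * M * M" by simp
      also have "t * (M * M) \<le> (e / (4 * M * M)) * (M * M)"
        using t M by (intro mult_right_mono) (auto simp: d_def)
      then have "2 * t * M * M \<le> e / 2" using M by (simp add: field_simps)
      finally show "dist (r \<zeta>) (r \<mu>) < e" using e by (simp add: D_def dist_norm)
    qed
  qed
  then have "uniformly_continuous_on (cball 0 1) r"
    by (rule compact_uniformly_continuous) simp
  then obtain \<delta> where \<delta>: "\<delta> > 0"
      "\<And>\<zeta> \<mu>. cmod \<zeta> \<le> 1 \<Longrightarrow> cmod \<mu> \<le> 1 \<Longrightarrow> cmod (\<zeta> - \<mu>) < \<delta> \<Longrightarrow> norm (r \<zeta> - r \<mu>) < 1/8"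
    unfolding uniformly_continuous_on_def dist_norm
    by (auto dest!: spec[of _ "1/8"] simp: norm_minus_commute)
  define w where "w k \<zeta> = scaleC (\<zeta> ^ (2 ^ k)) (z ^ (2 ^ k))" for k and \<zeta> :: complex
  define \<omega> where "\<omega> k = cis (pi / 2 ^ k)" for k :: nat
  \<comment> \<open>As \<open>\<omega> k ^ (2 ^ k) = -1\<close>, the two averaged terms invert
    \<open>1 - w k \<zeta>\<close> and \<open>1 + w k \<zeta>\<close>, and half the sum of these
    inverses inverts \<open>1 - w k \<zeta> * w k \<zeta>\<close>, which is
    \<open>1 - w (Suc k) \<zeta>\<close>.\<close>
  define F where "F = rec_nat r (\<lambda>k f \<zeta>. (1/2::real) *\<^sub>R (f \<zeta> + f (\<omega> k * \<zeta>)))"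
  have n\<omega>: "cmod (\<omega> k) = 1" for k by (simp add: \<omega>_def)
  have F0: "F 0 = r" and FS: "\<And>k \<zeta>. F (Suc k) \<zeta> = (1/2::real) *\<^sub>R (F k \<zeta> + F k (\<omega> k * \<zeta>))"
    by (simp_all add: F_def)
  have w_norm: "norm (w k \<zeta>) = cmod \<zeta> ^ (2 ^ k)" for k \<zeta>
    by (simp add: w_def norm_scaleC norm_self_adjoint_power[OF sa] n1 norm_power)
  have w\<omega>: "w k (\<omega> k * \<zeta>) = - w k \<zeta>" for k \<zeta>
  proof -
    have "\<omega> k ^ (2 ^ k) = -1" unfolding \<omega>_def Complex.DeMoivre by simp
    then show ?thesis by (simp add: w_def power_mult_distrib scaleC.minus_left)
  qed
  have wS: "w (Suc k) \<zeta> = w k \<zeta> * w k \<zeta>" for k \<zeta>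
    by (simp add: w_def scaleC_mult scaleC_scaleC power_add[symmetric] mult_2)
  have inv: "F k \<zeta> * (1 - w k \<zeta>) = 1" if "cmod \<zeta> \<le> 1" for k \<zeta>
    using that
  proof (induction k arbitrary: \<zeta>)
    case 0
    then show ?case using r by (simp add: F0 w_def)
  next
    case (Suc k)
    let ?w = "w k \<zeta>"
    have a: "F k \<zeta> * (1 - ?w) = 1" using Suc by simp
    have b: "F k (\<omega> k * \<zeta>) * (1 + ?w) = 1"
      using Suc.IH[of "\<omega> k * \<zeta>"] Suc.prems by (simp add: w\<omega> n\<omega> norm_mult)
    have "F (Suc k) \<zeta> * (1 - ?w * ?w)
        = (1/2::real) *\<^sub>R (F k \<zeta> * (1 - ?w) * (1 + ?w) + F k (\<omega> k * \<zeta>) * (1 + ?w) * (1 - ?w))"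
      by (simp add: FS algebra_simps)
    also have "\<dots> = 1" unfolding a b by (simp flip: scaleR_2)
    finally show ?case by (simp add: wS)
  qed
  \<comment> \<open>Rotation by \<open>\<omega> k\<close> preserves distances and averaging does not
    enlarge norms, so the \<open>\<delta>\<close> found for \<open>r\<close> serves every
    \<open>F k\<close>.\<close>
  have eqc: "norm (F k \<zeta> - F k \<mu>) < 1/8"
    if "cmod \<zeta> \<le> 1" "cmod \<mu> \<le> 1" "cmod (\<zeta> - \<mu>) < \<delta>" for k \<zeta> \<mu>
    using that
  proof (induction k arbitrary: \<zeta> \<mu>)
    case 0
    then show ?case using \<delta> by (simp add: F0)
  next
    case (Suc k)
    have "cmod (\<omega> k * \<zeta> - \<omega> k * \<mu>) = cmod (\<zeta> - \<mu>)"
      unfolding right_diff_distrib[symmetric] by (simp add: norm_mult n\<omega>)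
    then have 1: "norm (F k (\<omega> k * \<zeta>) - F k (\<omega> k * \<mu>)) < 1/8"
      using Suc.prems by (intro Suc.IH) (auto simp: norm_mult n\<omega>)
    have 2: "norm (F k \<zeta> - F k \<mu>) < 1/8" using Suc by simp
    have "F (Suc k) \<zeta> - F (Suc k) \<mu>
        = (1/2::real) *\<^sub>R ((F k \<zeta> - F k \<mu>) + (F k (\<omega> k * \<zeta>) - F k (\<omega> k * \<mu>)))"
      by (simp add: FS algebra_simps)
    then have "norm (F (Suc k) \<zeta> - F (Suc k) \<mu>)
        = (1/2) * norm ((F k \<zeta> - F k \<mu>) + (F k (\<omega> k * \<zeta>) - F k (\<omega> k * \<mu>)))"
      by simp
    also have "\<dots> < 1/8"
      using norm_triangle_ineq[of "F k \<zeta> - F k \<mu>" "F k (\<omega> k * \<zeta>) - F k (\<omega> k * \<mu>)"] 1 2 by simp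
    finally show ?case .
  qed
  \<comment> \<open>A radius below 1, where \<open>w k \<rho>\<close> tends to 0, yet within
    \<open>\<delta>\<close> of 1.\<close>
  define \<rho> where "\<rho> = max 0 (1 - \<delta>/2)"
  have \<rho>: "0 \<le> \<rho>" "\<rho> < 1" "1 - \<rho> < \<delta>" using \<delta>(1) by (auto simp: \<rho>_def)
  obtain k where k: "\<rho> ^ k < 1/8"
    using real_arch_pow_inv[OF _ \<rho>(2), of "1/8"] by auto
  have "\<rho> ^ (2 ^ k) \<le> \<rho> ^ k"
    using \<rho> by (intro power_decreasing) (auto intro: less_imp_le)
  then have wk: "norm (w k \<rho>) \<le> 1/8" using k \<rho> by (simp add: w_norm)
  define d where "d = norm (F k \<rho> - 1)"
  \<comment> \<open>This bounds \<open>d\<close> by \<open>(1 + d) / 8\<close>, hence by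
    \<open>1 / 7\<close>; moving from \<open>\<rho>\<close> to 1 costs less than
    \<open>1 / 8\<close>, so \<open>F k 1\<close> stays within \<open>1 / 2\<close> of 1.\<close>
  have "F k \<rho> - 1 = F k \<rho> * w k \<rho>"
    using inv[of "\<rho>" k] \<rho> by (simp add: algebra_simps)
  then have "d \<le> norm (F k \<rho>) * norm (w k \<rho>)"
    unfolding d_def by (metis norm_mult_ineq)
  also have "\<dots> \<le> (1 + d) * (1/8)"
    using wk norm_triangle_sub[of "F k \<rho>" 1] by (intro mult_mono) (auto simp: d_def)
  finally have d: "d \<le> 1/7" by simp
  have "cmod (complex_of_real \<rho> - 1) < \<delta>"
    using \<rho> by (metis norm_of_real of_real_1 of_real_diff abs_minus_commute abs_of_nonneg diff_ge_0_iff_ge less_imp_le)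
  then have "norm (F k \<rho> - F k 1) < 1/8" using \<rho> by (intro eqc) auto
  then have f: "norm (F k 1 - 1) < 1/2"
    using d norm_triangle_ineq4[of "F k \<rho> - 1" "F k \<rho> - F k 1"] by (simp add: d_def)
  \<comment> \<open>The left side has norm 1, the right side at most
    \<open>2 * norm (F k 1 - 1)\<close>, which is below 1.\<close>
  have "w k 1 = (F k 1 - 1) * (1 - w k 1)"
    using inv[of 1 k] by (simp add: algebra_simps)
  then have "1 \<le> norm (F k 1 - 1) * norm (1 - w k 1)"
    using w_norm[of k 1] by (metis norm_mult_ineq norm_one power_one)
  also have "\<dots> \<le> norm (F k 1 - 1) * 2"
    using norm_triangle_ineq4[of 1 "w k 1"] w_norm[of k 1] by (intro mult_left_mono) auto
  finally show False using f by simp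
qed

text \<open>After scaling to norm 1, a point \<open>\<zeta>\<close> of the disc where the resolvent
  fails gives the spectral point \<open>norm z / \<zeta>\<close>. The lemma bounds the norm by the
  spectral radius and also provides nonemptiness of the spectrum.\<close>

lemma self_adjoint_spectral_point:
  fixes z :: "'a::unital_cstar_algebra"
  assumes "self_adjoint z"
  shows "\<exists>\<mu>\<in>cspectrum z. norm z \<le> cmod \<mu>"
proof (cases "z = 0")
  case True
  have "0 \<in> cspectrum (0::'a)" by (simp add: cspectrum_def is_invertible_def scaleC.zero_left)
  with True show ?thesis by (auto intro!: bexI[of _ 0])
next
  case False
  define u where "u = scaleC (1 / norm z) z"
  have "self_adjoint u" "norm u = 1"
    using assms False by (simp_all add: u_def self_adjoint_def cstar_scaleC norm_scaleC norm_divide)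
  from resolvent_fails_on_unit_disc[OF this] obtain \<zeta> where
    l: "cmod \<zeta> \<le> 1" "\<not> is_invertible (1 - scaleC \<zeta> u)" by auto
  have nz: "\<zeta> \<noteq> 0" using l(2) is_invertible_one by (auto simp: scaleC.zero_left)
  define \<mu> where "\<mu> = norm z / \<zeta>"
  have "scaleC (- \<zeta> / norm z) (z - scaleC \<mu> 1) = 1 - scaleC \<zeta> u"
    using nz False
    by (simp add: \<mu>_def u_def scaleC.diff_right scaleC_scaleC scaleC_one scaleC.minus_left)
  then have "\<mu> \<in> cspectrum z"
    using l(2) is_invertible_scaleC[of "z - scaleC \<mu> 1" "- \<zeta> / norm z"] nz False
    by (auto simp: cspectrum_def)
  moreover have "norm z \<le> cmod \<mu>"
    using l(1) nz by (simp add: \<mu>_def norm_divide field_simps mult_left_le)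
  ultimately show ?thesis by blast
qed

text \<open>Adding \<open>\<i> * s\<close> to \<open>y\<close> moves the imaginary part
  \<open>b\<close> of the spectral point to \<open>b + s\<close>, while the C*-identity bounds the
  squared norm by \<open>norm y ^ 2 + s\<^sup>2\<close>. The squares of \<open>s\<close> cancel, and
  an expression linear in \<open>s\<close> would be bounded above.\<close>

lemma cspectrum_self_adjoint_real:
  assumes sa: "self_adjoint y" and \<mu>: "\<mu> \<in> cspectrum y"
  shows "Im \<mu> = 0"
proof (rule ccontr)
  assume nz: "Im \<mu> \<noteq> 0"
  define b where "b = Im \<mu>"
  have key: "(b + s)\<^sup>2 \<le> norm y ^ 2 + s\<^sup>2" for s :: real
  proof -
    define u where "u = y + scaleC (\<i> * s) 1"
    have "y - scaleC \<mu> 1 = u - scaleC (\<mu> + \<i> * s) 1"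
      by (simp add: u_def scaleC_add_left)
    then have "\<mu> + \<i> * s \<in> cspectrum u" using \<mu> by (simp add: cspectrum_def)
    then have le: "cmod (\<mu> + \<i> * s) \<le> norm u" by (rule cspectrum_norm_le)
    have "cstar u * u = y * y + scaleC (s\<^sup>2) 1"
      using sa by (simp add: u_def self_adjoint_def cstar_add cstar_scaleC algebra_simps scaleC_mult
          scaleC_scaleC scaleC.minus_left scaleC.diff_right power2_eq_square)
    then have "norm u ^ 2 = norm (y * y + scaleC (complex_of_real (s\<^sup>2)) 1)"
      using cstar_identity[of u] by simp
    also have "\<dots> \<le> norm y ^ 2 + s\<^sup>2"
      using norm_triangle_ineq[of "y * y" "scaleC (complex_of_real (s\<^sup>2)) 1"]
        norm_self_adjoint_square[OF sa] by (simp add: norm_scaleC norm_power)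
    finally have "norm u ^ 2 \<le> norm y ^ 2 + s\<^sup>2" .
    moreover have "(cmod (\<mu> + \<i> * s))\<^sup>2 \<le> norm u ^ 2" using le by (intro power_mono) auto
    moreover have "(b + s)\<^sup>2 \<le> (cmod (\<mu> + \<i> * s))\<^sup>2"
      unfolding cmod_power2 by (simp add: b_def)
    ultimately show ?thesis by linarith
  qed
  have "b\<^sup>2 + 2 * b * s \<le> norm y ^ 2" for s :: real
    using key[of s] by (simp add: power2_eq_square algebra_simps)
  \<comment> \<open>This \<open>s\<close> makes \<open>2 * b * s\<close> equal to
    \<open>norm y ^ 2 + 1\<close>.\<close>
  from this[of "(norm y ^ 2 + 1) / (2 * b)"] have "b\<^sup>2 + (norm y ^ 2 + 1) \<le> norm y ^ 2"
    using nz by (simp add: b_def)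
  then show False using zero_le_power2[of b] by linarith
qed

section \<open>Polynomials in an element and their spectra\<close>

definition poly_apply :: "complex poly \<Rightarrow> 'a::unital_cstar_algebra \<Rightarrow> 'a" where
  "poly_apply p y = fold_coeffs (\<lambda>a b. scaleC a 1 + y * b) p 0"

lemma poly_apply_0 [simp]: "poly_apply 0 y = 0"
  by (simp add: poly_apply_def)

lemma poly_apply_pCons [simp]: "poly_apply (pCons a p) y = scaleC a 1 + y * poly_apply p y"
  by (cases "p = 0 \<and> a = 0") (auto simp: poly_apply_def scaleC.zero_left)

lemma poly_apply_1 [simp]: "poly_apply 1 y = 1"
  by (simp add: one_pCons scaleC_one)

lemma poly_apply_add: "poly_apply (p + q) y = poly_apply p y + poly_apply q y"
  by (induction p q rule: poly_induct2) (simp_all add: scaleC_add_left algebra_simps)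

lemma poly_apply_smult: "poly_apply (smult c p) y = scaleC c (poly_apply p y)"
  by (induction p) (simp_all add: scaleC_add_right scaleC_mult scaleC_scaleC)

lemma poly_apply_mult: "poly_apply (p * q) y = poly_apply p y * poly_apply q y"
  by (induction p)
    (simp_all add: poly_apply_add poly_apply_smult scaleC.zero_left distrib_right scaleC_mult mult.assoc)

text \<open>The fundamental theorem of algebra splits off linear factors, and each factor
  \<open>y - c\<close> at a root \<open>c\<close> is invertible.\<close>

lemma is_invertible_poly_apply:
  assumes "p \<noteq> 0" "\<And>c. poly p c = 0 \<Longrightarrow> c \<notin> cspectrum y"
  shows "is_invertible (poly_apply p y)"
  using assms
proof (induction "degree p" arbitrary: p)
  case 0
  then obtain c where "p = [:c:]" by (metis degree_eq_zeroE)
  then show ?case using 0 is_invertible_scaleC[OF is_invertible_one, of c] by simp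
next
  case (Suc n)
  have "\<not> constant (poly p)" using Suc.hyps(2) by (simp add: constant_degree)
  then obtain c where c: "poly p c = 0" using fundamental_theorem_of_algebra by blast
  then obtain q where q: "p = [:- c, 1:] * q" by (auto simp: poly_eq_0_iff_dvd elim: dvdE)
  have q0: "q \<noteq> 0" using q Suc.prems by auto
  have "degree p = degree q + 1" unfolding q using q0 by (subst degree_mult_eq) auto
  then have "is_invertible (poly_apply q y)"
    using Suc.prems Suc.hyps q q0 by (intro Suc.hyps(1)) auto
  moreover have "is_invertible (poly_apply [:- c, 1:] y)"
    using Suc.prems(2)[OF c] by (simp add: cspectrum_def scaleC.minus_left scaleC_one)
  ultimately show ?case unfolding q poly_apply_mult by (intro is_invertible_mult)
qed

text \<open>If \<open>p\<close> does not take the value \<open>c\<close> on the spectrum, the roots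
  of \<open>p - c\<close> avoid the spectrum. The constant \<open>c\<close> is set apart because
  \<open>p - c\<close> is then the zero polynomial.\<close>

lemma cspectrum_poly_apply:
  assumes "c \<in> cspectrum (poly_apply p y)"
  shows "(\<exists>\<mu>\<in>cspectrum y. poly p \<mu> = c) \<or> p = [:c:]"
proof (rule ccontr)
  assume n: "\<not> ?thesis"
  have "poly_apply (p + [:- c:]) y = poly_apply p y - scaleC c 1"
    by (simp add: poly_apply_add scaleC.minus_left)
  moreover have "p + [:- c:] \<noteq> 0"
    using n by (metis add.inverse_inverse add_eq_0_iff minus_pCons minus_zero)
  then have "is_invertible (poly_apply (p + [:- c:]) y)"
    using n by (intro is_invertible_poly_apply) auto
  ultimately show False using assms by (simp add: cspectrum_def)
qed

text \<open>Both claims are proved together, since a product of self-adjoint elements is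
  self-adjoint only if they commute. Real roots keep each factor self-adjoint.\<close>

lemma poly_apply_prod_self_adjoint:
  assumes "self_adjoint y" "finite S"
  defines "P \<equiv> \<lambda>S. poly_apply (\<Prod>a\<in>S. [:- complex_of_real a, 1:]) y"
  shows "self_adjoint (P S)" "P S * y = y * P S"
proof -
  have "self_adjoint (P S) \<and> P S * y = y * P S" using assms(2)
  proof (induction S rule: finite_induct)
    case empty
    then show ?case by (simp add: P_def self_adjoint_def)
  next
    case (insert a S)
    have "P (insert a S) = (y - scaleC a 1) * P S"
      unfolding P_def prod.insert[OF insert(1,2)] poly_apply_mult
      by (simp add: scaleC.minus_left scaleC_one)
    then have P: "P (insert a S) = y * P S - scaleC a (P S)"
      by (simp add: left_diff_distrib scaleC_mult)
    have sa: "cstar y = y" "cstar (P S) = P S" and comm: "P S * y = y * P S"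
      using insert assms(1) by (simp_all add: self_adjoint_def)
    have "P S * (y * y) = y * (P S * y)" using comm by (metis mult.assoc)
    then show ?case unfolding P self_adjoint_def
      by (simp add: cstar_mult cstar_diff cstar_scaleC sa comm left_diff_distrib right_diff_distrib
          scaleC_mult mult.assoc)
  qed
  then show "self_adjoint (P S)" "P S * y = y * P S" by blast+
qed

text \<open>Take the spectrum, which is real, as the set of roots: the resulting polynomial in
  \<open>y\<close> is self-adjoint and has no spectral value other than 0, so its norm
  vanishes.\<close>

lemma finite_cspectrum_annihilator:
  fixes y :: "'a::unital_cstar_algebra"
  assumes sa: "self_adjoint y" and fin: "finite (cspectrum y)"
  shows "\<exists>S. finite S \<and> poly_apply (\<Prod>a\<in>S. [:- complex_of_real a, 1:]) y = 0"
proof (intro exI conjI)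
  let ?S = "Re ` cspectrum y"
  let ?p = "\<Prod>a\<in>?S. [:- complex_of_real a, 1:]"
  show S: "finite ?S" using fin by simp
  obtain \<mu> where mu: "\<mu> \<in> cspectrum (poly_apply ?p y)" "norm (poly_apply ?p y) \<le> cmod \<mu>"
    using self_adjoint_spectral_point[OF poly_apply_prod_self_adjoint(1)[OF sa S]] by blast
  have root: "poly ?p \<nu> = 0" if "\<nu> \<in> cspectrum y" for \<nu>
  proof -
    have "complex_of_real (Re \<nu>) = \<nu>"
      using cspectrum_self_adjoint_real[OF sa that] by (simp add: complex_eq_iff)
    then show ?thesis using S that by (auto simp: poly_prod intro!: prod_zero bexI[of _ \<nu>])
  qed
  \<comment> \<open>A spectral point of \<open>y\<close> settles the constant case: the constant
    must equal the value 0 taken there.\<close>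
  obtain \<nu>\<^sub>0 where "\<nu>\<^sub>0 \<in> cspectrum y" using self_adjoint_spectral_point[OF sa] by blast
  then have "\<mu> = 0" using cspectrum_poly_apply[OF mu(1)] root by auto
  then show "poly_apply ?p y = 0" using mu(2) by simp
qed

section \<open>Partitions of unity by projections\<close>

text \<open>Members may vanish, so that refinements need not be reindexed.\<close>

definition proj_partition :: "'i set \<Rightarrow> ('i \<Rightarrow> 'a::unital_cstar_algebra) \<Rightarrow> bool" where
  "proj_partition I e \<longleftrightarrow> finite I \<and> (\<forall>i\<in>I. is_projection (e i)) \<and>
     (\<forall>i\<in>I. \<forall>j\<in>I. i \<noteq> j \<longrightarrow> e i * e j = 0) \<and> sum e I = 1"

definition lincomb :: "'i set \<Rightarrow> ('i \<Rightarrow> 'a::unital_cstar_algebra) \<Rightarrow> ('i \<Rightarrow> complex) \<Rightarrow> 'a" where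
  "lincomb I e c = (\<Sum>i\<in>I. scaleC (c i) (e i))"

lemma lincomb_cong:
  "(\<And>i. i \<in> I \<Longrightarrow> e i \<noteq> 0 \<Longrightarrow> c i = d i) \<Longrightarrow> lincomb I e c = lincomb I e d"
  unfolding lincomb_def by (intro sum.cong refl) (metis scaleC.zero_right)

lemma lincomb_add: "lincomb I e (\<lambda>i. c i + d i) = lincomb I e c + lincomb I e d"
  by (simp add: lincomb_def scaleC_add_left sum.distrib)

lemma lincomb_diff: "lincomb I e (\<lambda>i. c i - d i) = lincomb I e c - lincomb I e d"
  by (simp add: lincomb_def scaleC.diff_left sum_subtractf)

lemma lincomb_scaleC: "lincomb I e (\<lambda>i. a * c i) = scaleC a (lincomb I e c)"
  by (simp add: lincomb_def scaleC.sum_right scaleC_scaleC)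

context
  fixes I :: "'i set" and e :: "'i \<Rightarrow> 'a::unital_cstar_algebra"
  assumes part: "proj_partition I e"
begin

lemma proj_partitionD:
  "finite I" "sum e I = 1" "i \<in> I \<Longrightarrow> e i * e i = e i" "i \<in> I \<Longrightarrow> cstar (e i) = e i"
  "i \<in> I \<Longrightarrow> j \<in> I \<Longrightarrow> i \<noteq> j \<Longrightarrow> e i * e j = 0"
  using part by (auto simp: proj_partition_def is_projection_def)

lemma lincomb_1: "lincomb I e (\<lambda>i. 1) = 1"
  by (simp add: lincomb_def scaleC_one proj_partitionD(2))

lemma lincomb_times_member:
  assumes "i \<in> I"
  shows "lincomb I e c * e i = scaleC (c i) (e i)" "e i * lincomb I e c = scaleC (c i) (e i)"
proof -
  have 1: "scaleC (c j) (e j) * e i = (if j = i then scaleC (c i) (e i) else 0)"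
      "e i * scaleC (c j) (e j) = (if j = i then scaleC (c i) (e i) else 0)" if "j \<in> I" for j
    using that assms proj_partitionD by (auto simp: scaleC_mult)
  show "lincomb I e c * e i = scaleC (c i) (e i)" "e i * lincomb I e c = scaleC (c i) (e i)"
    unfolding lincomb_def sum_distrib_left sum_distrib_right
    using assms proj_partitionD(1) by (simp_all add: 1 cong: sum.cong)
qed

lemma lincomb_mult: "lincomb I e c * lincomb I e d = lincomb I e (\<lambda>i. c i * d i)"
proof -
  have "lincomb I e c * lincomb I e d = (\<Sum>i\<in>I. scaleC (d i) (lincomb I e c * e i))"
    unfolding lincomb_def[of I e d] sum_distrib_left by (simp add: scaleC_mult)
  also have "\<dots> = lincomb I e (\<lambda>i. c i * d i)"
    unfolding lincomb_def[of I e "\<lambda>i. c i * d i"]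
    by (intro sum.cong refl) (simp add: lincomb_times_member scaleC_scaleC mult.commute)
  finally show ?thesis .
qed

lemma cstar_lincomb: "cstar (lincomb I e c) = lincomb I e (\<lambda>i. cnj (c i))"
  by (simp add: lincomb_def cstar_sum cstar_scaleC proj_partitionD cong: sum.cong)

lemma eq_lincombI:
  assumes "\<And>i. i \<in> I \<Longrightarrow> x * e i = scaleC (c i) (e i)"
  shows "x = lincomb I e c"
proof -
  have "x = (\<Sum>i\<in>I. x * e i)" by (simp add: proj_partitionD(2) flip: sum_distrib_left)
  also have "\<dots> = lincomb I e c" unfolding lincomb_def by (intro sum.cong refl assms)
  finally show ?thesis .
qed

text \<open>The C*-identity reduces the claim to the self-adjoint \<open>a\<close> with coefficients
  \<open>d i\<close>, the squared moduli. A spectral value of \<open>a\<close> dominating its norm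
  must be some \<open>d i\<close> with \<open>e i\<close> nonzero, since otherwise the combination
  with coefficients \<open>1 / (d i - \<mu>)\<close> inverts \<open>a - \<mu>\<close>.\<close>

lemma norm_lincomb_le:
  assumes bd: "\<And>i. i \<in> I \<Longrightarrow> e i \<noteq> 0 \<Longrightarrow> cmod (c i) \<le> K" and K: "0 \<le> K"
  shows "norm (lincomb I e c) \<le> K"
proof -
  define d where "d i = cnj (c i) * c i" for i
  have d: "cnj (d i) = d i" for i by (simp add: d_def mult.commute)
  define a where "a = lincomb I e d"
  have a: "cstar (lincomb I e c) * lincomb I e c = a"
    unfolding a_def d_def cstar_lincomb lincomb_mult ..
  have "self_adjoint a" unfolding self_adjoint_def a_def cstar_lincomb d ..
  then obtain \<mu> where mu: "\<mu> \<in> cspectrum a" "norm a \<le> cmod \<mu>"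
    using self_adjoint_spectral_point by blast
  have "\<exists>i\<in>I. e i \<noteq> 0 \<and> d i = \<mu>"
  proof (rule ccontr)
    assume n: "\<not> ?thesis"
    have s: "a - scaleC \<mu> 1 = lincomb I e (\<lambda>i. d i - \<mu> * 1)"
      unfolding a_def lincomb_diff lincomb_scaleC lincomb_1 ..
    define b where "b = lincomb I e (\<lambda>i. 1 / (d i - \<mu>))"
    have "(a - scaleC \<mu> 1) * b = lincomb I e (\<lambda>i. 1)" "b * (a - scaleC \<mu> 1) = lincomb I e (\<lambda>i. 1)"
      unfolding s b_def lincomb_mult using n by (auto intro!: lincomb_cong)
    then have "is_invertible (a - scaleC \<mu> 1)" unfolding is_invertible_def lincomb_1 by blast
    with mu(1) show False by (simp add: cspectrum_def)
  qed
  then obtain i where i: "i \<in> I" "e i \<noteq> 0" "d i = \<mu>" by blast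
  have "cmod (d i) = cmod (c i) ^ 2" by (simp add: d_def norm_mult power2_eq_square)
  also have "\<dots> \<le> K ^ 2" using bd i K by (intro power_mono) auto
  finally have "norm (lincomb I e c) ^ 2 \<le> K ^ 2"
    using cstar_identity[of "lincomb I e c"] a i mu(2) by simp
  then show ?thesis using K by (rule power2_le_imp_le)
qed

end

section \<open>Lifting projections\<close>

lemma poly_apply_eigen:
  assumes "y * b = scaleC m b"
  shows "poly_apply p y * b = scaleC (poly p m) b"
proof (induction p)
  case (pCons a p)
  have "y * poly_apply p y * b = scaleC (m * poly p m) b"
    using pCons.IH assms by (simp add: mult.assoc scaleC_mult scaleC_scaleC mult.commute)
  then show ?case by (simp add: distrib_right scaleC_mult scaleC_add_left)
qed (simp add: scaleC.zero_left)

lemma poly_apply_commute: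
  assumes "a * y = y * a"
  shows "a * poly_apply p y = poly_apply p y * a"
proof (induction p)
  case (pCons c p)
  have "a * (y * poly_apply p y) = y * poly_apply p y * a"
    using pCons.IH assms by (metis mult.assoc)
  then show ?case by (simp add: distrib_left distrib_right scaleC_mult)
qed simp

text \<open>Induction on the roots: Lagrange interpolation cuts out of \<open>a\<close> the
  eigenprojection \<open>b\<close> for the new root \<open>m\<close>, and the product over the other
  roots annihilates \<open>a - b\<close>. A general projection \<open>a\<close> instead of 1 makes
  the induction go through.\<close>

lemma projection_eigen_decomposition:
  fixes y a :: "'a::unital_cstar_algebra"
  assumes sa: "self_adjoint y" and "finite S" "is_projection a" "a * y = y * a"
    and "a * poly_apply (\<Prod>s\<in>S. [:- complex_of_real s, 1:]) y = 0"
  shows "\<exists>e. (\<forall>s\<in>S. is_projection (e s) \<and> y * e s = scaleC (complex_of_real s) (e s)) \<and> sum e S = a"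
  using assms(2-)
proof (induction S arbitrary: a rule: finite_induct)
  case empty
  then show ?case by simp
next
  case (insert m S)
  define p where "p = (\<Prod>s\<in>S. [:- complex_of_real s, 1:])"
  define Q where "Q = poly_apply p y"
  \<comment> \<open>The value of \<open>p\<close> at the new root. Since \<open>Q\<close> acts on
    \<open>b\<close> as multiplication by \<open>c\<close>, dividing by it makes \<open>b\<close>
    idempotent.\<close>
  define c where "c = (\<Prod>s\<in>S. m - s)"
  define b where "b = scaleC (1 / c) (a * Q)"
  have c: "c \<noteq> 0" and pm: "poly p m = complex_of_real c"
    using insert.hyps by (auto simp: c_def p_def poly_prod)
  have aa: "a * a = a" "cstar a = a" using insert.prems by (auto simp: is_projection_def)
  have Qc: "a * Q = Q * a" unfolding Q_def by (intro poly_apply_commute insert.prems)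
  have Qs: "cstar Q = Q" and Qy: "Q * y = y * Q"
    using poly_apply_prod_self_adjoint[OF sa insert.hyps(1)]
    by (simp_all add: Q_def p_def self_adjoint_def)
  have cs: "cstar b = b"
    by (simp add: b_def cstar_scaleC cstar_mult aa Qs Qc)
  have "a * ((y - scaleC m 1) * Q) = 0"
    using insert.prems(3) unfolding prod.insert[OF insert.hyps] poly_apply_mult
    by (simp add: Q_def p_def scaleC.minus_left scaleC_one)
  moreover have "a * (y * Q) = y * (a * Q)" using insert.prems(2) by (metis mult.assoc)
  ultimately have "y * (a * Q) = scaleC m (a * Q)"
    by (simp add: left_diff_distrib right_diff_distrib scaleC_mult)
  then have yb: "y * b = scaleC m b" by (simp add: b_def scaleC_mult scaleC_scaleC mult.commute)
  then have Qb: "Q * b = scaleC c b" unfolding Q_def by (simp add: poly_apply_eigen pm)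
  have ab: "a * b = b" by (simp add: b_def scaleC_mult aa flip: mult.assoc)
  then have ba: "b * a = b" using aa(2) cs by (metis cstar_mult)
  have by': "b * y = y * b"
  proof -
    have "b * y = cstar (y * b)" using sa cs by (simp add: self_adjoint_def cstar_mult)
    then show ?thesis by (simp add: yb cstar_scaleC cs)
  qed
  have bQ: "b * Q = scaleC c b"
    using arg_cong[OF Qb, of cstar] Qs cs by (simp add: cstar_mult cstar_scaleC)
  have "a * Q * b = scaleC c b" by (simp add: mult.assoc Qb scaleC_mult ab)
  then have bb: "b * b = b" using c by (simp add: b_def scaleC_mult scaleC_scaleC scaleC_one)
  have "is_projection (a - b)"
    unfolding is_projection_def by (simp add: left_diff_distrib right_diff_distrib aa ab ba bb cstar_diff cs)
  moreover have "(a - b) * y = y * (a - b)"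
    using insert.prems(2) by' by (simp add: left_diff_distrib right_diff_distrib)
  moreover have "a * Q = scaleC c b" using c by (simp add: b_def scaleC_scaleC scaleC_one)
  then have "(a - b) * poly_apply (\<Prod>s\<in>S. [:- complex_of_real s, 1:]) y = 0"
    using bQ by (simp add: left_diff_distrib Q_def p_def)
  ultimately obtain e where e: "sum e S = a - b"
      "\<And>s. s \<in> S \<Longrightarrow> is_projection (e s) \<and> y * e s = scaleC (complex_of_real s) (e s)"
    using insert.IH by blast
  have "sum (e(m := b)) (insert m S) = b + sum e S"
    using insert.hyps by (auto intro!: sum.cong)
  then show ?case using e yb bb cs by (intro exI[of _ "e(m := b)"]) (auto simp: is_projection_def)
qed

lemma finite_cspectrum_decomposition:
  fixes y :: "'a::unital_cstar_algebra"
  assumes sa: "self_adjoint y" and fin: "finite (cspectrum y)"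
  shows "\<exists>S e. proj_partition S e \<and> y = lincomb S e complex_of_real"
proof -
  obtain S where S: "finite S" "poly_apply (\<Prod>s\<in>S. [:- complex_of_real s, 1:]) y = 0"
    using finite_cspectrum_annihilator[OF assms] by blast
  obtain e where e: "sum e S = 1"
      "\<And>s. s \<in> S \<Longrightarrow> is_projection (e s)" "\<And>s. s \<in> S \<Longrightarrow> y * e s = scaleC (complex_of_real s) (e s)"
    using projection_eigen_decomposition[OF sa S(1), of 1] S(2) by (auto simp: is_projection_def)
  \<comment> \<open>Evaluating \<open>e s * y * e t\<close> from either side gives both
    \<open>s\<close> and \<open>t\<close> times \<open>e s * e t\<close>.\<close>
  have "e s * e t = 0" if st: "s \<in> S" "t \<in> S" "s \<noteq> t" for s t
  proof -
    have "e s * y = scaleC (complex_of_real s) (e s)"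
      using arg_cong[OF e(3)[OF st(1)], of cstar] e(2)[OF st(1)] sa
      by (simp add: self_adjoint_def is_projection_def cstar_mult cstar_scaleC)
    then have "scaleC (complex_of_real s) (e s * e t) = e s * (y * e t)"
      by (metis scaleC_mult_left mult.assoc)
    also have "\<dots> = scaleC (complex_of_real t) (e s * e t)" by (simp add: e(3) st(2) scaleC_mult)
    finally show ?thesis using scaleC_right_cancel st(3) of_real_eq_iff by blast
  qed
  then have part: "proj_partition S e" using S(1) e by (auto simp: proj_partition_def)
  with eq_lincombI[OF part, of y complex_of_real] e(3) show ?thesis by blast
qed

lemma star_homD:
  assumes "star_hom f"
  shows "f (x + y) = f x + f y" "f (scaleC c x) = scaleC c (f x)" "f (x * y) = f x * f y"
    "f (cstar x) = cstar (f x)" "f 0 = 0" "f (x - y) = f x - f y"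
proof -
  show *: "f (x + y) = f x + f y" "f (scaleC c x) = scaleC c (f x)" "f (x * y) = f x * f y"
    "f (cstar x) = cstar (f x)" for x y c
    using assms by (simp_all add: star_hom_def)
  show "f 0 = 0" using *(1)[of 0 0] by simp
  show "f (x - y) = f x - f y" using *(1)[of "x - y" y] by simp
qed

lemma real_rank_zero_lift_projection:
  fixes \<pi> :: "'b::unital_cstar_algebra \<Rightarrow> 'm::unital_cstar_algebra"
  assumes rr0: "real_rank_zero TYPE('b)" and hom: "star_hom \<pi>" and unital: "\<pi> 1 = 1"
    and surj: "surj \<pi>"
    and f: "is_projection f" and q: "is_projection q" and fq: "\<pi> f * q = q"
  shows "\<exists>t. is_projection t \<and> f * t = t \<and> \<pi> t = q"
proof -
  note hom = star_homD[OF hom]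
  have ff: "f * f = f" "cstar f = f" and qq: "q * q = q" "cstar q = q"
    using f q by (auto simp: is_projection_def)
  have qf: "q * \<pi> f = q" using arg_cong[OF fq, of cstar] by (simp add: cstar_mult qq ff flip: hom)
  obtain x\<^sub>0 where x0: "\<pi> x\<^sub>0 = q" using surj by (metis surjD)
  \<comment> \<open>Symmetrizing makes the lift self-adjoint and compressing puts it below
    \<open>f\<close>. The image remains \<open>q\<close>, which is self-adjoint and fixed by
    \<open>\<pi> f\<close> on both sides.\<close>
  define x where "x = f * (scaleC (1/2) (x\<^sub>0 + cstar x\<^sub>0)) * f"
  have xs: "cstar x = x" by (simp add: x_def cstar_mult cstar_scaleC cstar_add cstar_cstar ff mult.assoc add.commute)
  have fx: "f * x = x" by (simp add: x_def ff flip: mult.assoc)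
  have "scaleC (1/2) (q + q) = q"
    by (simp add: scaleC_add_right scaleC_one flip: scaleC_add_left)
  then have px: "\<pi> x = q"
    by (simp add: x_def hom x0 qq fq qf)
  have cont: "((\<lambda>y. y * y) \<longlongrightarrow> x * x) (at x)" by (intro tendsto_intros)
  then obtain d where d: "d > 0" "\<And>y. dist y x < d \<Longrightarrow> dist (y * y) (x * x) < 1/4"
    unfolding Lim_at by (metis dist_self zero_less_divide_1_iff zero_less_numeral zero_less_dist_iff)
  have "x \<in> closure {y. self_adjoint y \<and> finite (cspectrum y)}"
    using rr0 xs by (simp add: real_rank_zero_def self_adjoint_def)
  then obtain y where y: "self_adjoint y" "finite (cspectrum y)" "dist y x < min d (1/4)"
    using d(1) unfolding closure_approachable by (metis (mono_tags, lifting) mem_Collect_eq min_less_iff_conj zero_less_divide_1_iff zero_less_numeral)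
  have near: "norm (x - y) < 1/4" "norm (x * x - y * y) < 1/4"
    using y(3) d(2)[of y] by (simp_all add: dist_norm norm_minus_commute)
  obtain S e where part: "proj_partition S e" and ye: "y = lincomb S e complex_of_real"
    using finite_cspectrum_decomposition[OF y(1,2)] by blast
  \<comment> \<open>Where \<open>h\<close> is 0, \<open>(1 - E) * y\<close> has norm at most
    \<open>1/2\<close>, so \<open>(1 - E) * x\<close> has norm at most \<open>3/4\<close>. Where
    \<open>h\<close> is 1, \<open>1 / (s * s)\<close> is at most 4, which matches the error below
    \<open>1/4\<close> in \<open>x * x\<close>.\<close>
  define h where "h s = (if \<bar>s\<bar> > 1/2 then 1 else 0 :: complex)" for s :: real
  define E where "E = lincomb S e h"
  note mult = lincomb_mult[OF part] and le = norm_lincomb_le[OF part] and one = lincomb_1[OF part]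
  have EE: "E * E = E" unfolding E_def mult by (rule lincomb_cong) (simp add: h_def)
  have Es: "cstar E = E"
    unfolding E_def cstar_lincomb[OF part] by (rule lincomb_cong) (simp add: h_def)
  have nE: "norm E \<le> 1" by (rule norm_projection_le) (simp add: is_projection_def EE Es)
  have E1: "1 - E = lincomb S e (\<lambda>s. 1 - h s)" unfolding E_def lincomb_diff one ..
  have "norm ((1 - E) * y) \<le> 1/2"
    unfolding E1 ye mult by (rule le) (auto simp: h_def norm_mult)
  moreover have "norm (1 - E) \<le> 1"
    unfolding E1 by (rule le) (auto simp: h_def)
  then have "norm ((1 - E) * (x - y)) \<le> 1 * (1/4)"
    using near(1) by (intro order.trans[OF norm_mult_ineq] mult_mono) auto
  ultimately have "norm ((1 - E) * x) < 1"
    using norm_triangle_ineq[of "(1 - E) * y" "(1 - E) * (x - y)"] by (simp add: right_diff_distrib)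
  from is_invertible_one_minus[OF this] obtain r where r: "(1 - (1 - E) * x) * r = 1"
    by (auto simp: is_invertible_def)
  \<comment> \<open>Adding \<open>1 - E\<close> turns invertibility in the corner of
    \<open>E\<close> into invertibility in the whole algebra; \<open>k\<close> inverts the same
    expression with \<open>y\<close> in place of \<open>x\<close>.\<close>
  define z where "z = E * (x * x) * E + (1 - E)"
  define k where "k = lincomb S e (\<lambda>s. if \<bar>s\<bar> > 1/2 then 1 / complex_of_real (s * s) else 1)"
  have "norm k \<le> 4"
    unfolding k_def
  proof (rule le)
    fix s :: real
    have "1 / (s * s) \<le> 4" if "\<bar>s\<bar> > 1/2"
    proof -
      have "(1/2)\<^sup>2 \<le> \<bar>s\<bar>\<^sup>2" using that by (intro power_mono) auto
      then have "1/4 \<le> s * s" by (simp add: power2_eq_square)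
      then show ?thesis by (simp add: divide_simps)
    qed
    then show "cmod (if \<bar>s\<bar> > 1/2 then 1 / complex_of_real (s * s) else 1) \<le> 4"
      by (simp add: norm_divide norm_mult)
  qed simp
  have kz: "k * (E * (y * y) * E + (1 - E)) = 1"
  proof -
    have "E * (y * y) * E + (1 - E) = lincomb S e (\<lambda>s. h s * (complex_of_real s * s) * h s + (1 - h s))"
      unfolding E1 lincomb_add by (simp only: E_def ye mult)
    then show ?thesis
      unfolding k_def by (simp only: mult) (subst one[symmetric], rule lincomb_cong, auto simp: h_def)
  qed
  have "norm (E * (x * x - y * y) * E) \<le> 1 * norm (x * x - y * y) * 1"
    using nE by (intro order.trans[OF norm_mult_ineq] mult_mono) (auto intro: mult_nonneg_nonneg)
  then have "norm (k * (E * (x * x - y * y) * E)) \<le> 4 * norm (x * x - y * y)"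
    using \<open>norm k \<le> 4\<close>
    by (intro order.trans[OF norm_mult_ineq[of k]] mult_mono) auto
  then have "norm (- (k * (E * (x * x - y * y) * E))) < 1" using near(2) by simp
  \<comment> \<open>Passing from \<open>y\<close> to \<open>x\<close> perturbs 1 by less than norm
    1, so \<open>m * k\<close> becomes a left inverse of \<open>z\<close>.\<close>
  from is_invertible_one_minus[OF this] obtain m where m: "m * (1 + k * (E * (x * x - y * y) * E)) = 1"
    by (auto simp: is_invertible_def)
  have "k * z = k * (E * (y * y) * E + (1 - E)) + k * (E * (x * x - y * y) * E)"
    by (simp add: z_def algebra_simps)
  then have "k * z = 1 + k * (E * (x * x - y * y) * E)" by (simp only: kz)
  with m have lz: "(m * k) * z = 1" by (simp add: mult.assoc)
  define l where "l = m * k"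
  have zs: "cstar z = z" by (simp add: z_def cstar_add cstar_mult cstar_diff Es xs mult.assoc)
  \<comment> \<open>As \<open>z\<close> is self-adjoint, the adjoint of its left inverse is a right
    inverse, so the two coincide.\<close>
  have "z * cstar l = 1" using arg_cong[OF lz, of cstar] zs by (simp add: l_def cstar_mult mult.assoc)
  then have ls: "cstar l = l" and lz: "l * z = 1" and zl: "z * l = 1"
    using lz unfolding l_def[symmetric] by (metis mult.assoc mult.right_neutral mult.left_neutral)+
  have zE: "E * x * x * E = z * E" "z * E = E * z"
    by (simp_all add: z_def EE algebra_simps) (simp_all add: EE flip: mult.assoc)
  have lE: "l * E = E * l"
    by (metis zE(2) lz zl mult.assoc mult.right_neutral mult.left_neutral)
  \<comment> \<open>With \<open>v = x * E\<close> this is \<open>v * l * cstar v\<close>, the range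
    projection of \<open>v\<close>, because \<open>l\<close> inverts \<open>cstar v * v\<close> in
    the corner of \<open>E\<close>.\<close>
  define t where "t = x * E * l * E * x"
  have "t * t = x * E * l * (E * x * x * E) * l * E * x" by (simp add: t_def mult.assoc)
  also have "\<dots> = x * E * (l * z) * (E * l * E) * x" unfolding zE(1) by (simp add: mult.assoc)
  also have "\<dots> = x * (E * E) * l * E * x" unfolding lz by (simp add: mult.assoc)
  finally have tt: "t * t = t" by (simp add: EE t_def)
  have ts: "cstar t = t" by (simp add: t_def cstar_mult Es xs ls mult.assoc)
  have ft: "f * t = t" by (simp add: t_def fx flip: mult.assoc)
  \<comment> \<open>The defect satisfies \<open>s * q = s\<close>, and
    \<open>s * \<pi> E = 0\<close> because \<open>t\<close> fixes \<open>x * E\<close>. Hence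
    \<open>s\<close> kills the image of \<open>1 - (1 - E) * x\<close>, and the right inverse
    \<open>r\<close> forces \<open>s = 0\<close>.\<close>
  define s where "s = q - \<pi> t"
  have sq: "s * q = s" by (simp add: s_def left_diff_distrib qq t_def hom px mult.assoc)
  have "t * (x * E) = x * E * l * (E * x * x * E)" by (simp add: t_def mult.assoc)
  also have "\<dots> = x * E * (l * z) * E" unfolding zE(1) by (simp add: mult.assoc)
  finally have "t * (x * E) = x * E" by (simp add: lz EE mult.assoc)
  from arg_cong[OF this, of \<pi>] have "\<pi> t * (q * \<pi> E) = q * \<pi> E" by (simp add: hom px)
  then have "s * (q * \<pi> E) = 0"
    unfolding s_def left_diff_distrib by (simp add: qq flip: mult.assoc)
  then have sE: "s * \<pi> E = 0" by (simp add: sq flip: mult.assoc)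
  have "s * \<pi> (1 - (1 - E) * x) = s - (s - s * \<pi> E) * q"
    by (simp add: hom unital px algebra_simps)
  then have "s * \<pi> (1 - (1 - E) * x) = 0" by (simp add: sE sq)
  then have "s * \<pi> ((1 - (1 - E) * x) * r) = 0" by (simp add: hom(3) flip: mult.assoc)
  then have "\<pi> t = q" by (simp add: r unital s_def)
  with tt ts ft show ?thesis unfolding is_projection_def by blast
qed

section \<open>Contractivity of unital homomorphisms\<close>

lemma star_hom_cspectrum:
  assumes "star_hom \<pi>" "\<pi> 1 = 1"
  shows "cspectrum (\<pi> x) \<subseteq> cspectrum x"
proof -
  have "is_invertible (\<pi> x - scaleC c 1)" if inv: "is_invertible (x - scaleC c 1)" for c
  proof -
    obtain y where "(x - scaleC c 1) * y = 1" "y * (x - scaleC c 1) = 1"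
      using inv unfolding is_invertible_def by blast
    from arg_cong[OF this(1), of \<pi>] arg_cong[OF this(2), of \<pi>] show ?thesis
      by (auto simp: is_invertible_def star_homD[OF assms(1)] assms(2))
  qed
  then show ?thesis by (auto simp: cspectrum_def)
qed

text \<open>Spectra shrink under \<open>\<pi>\<close>, and a spectral value dominates the norm of
  the self-adjoint \<open>\<pi> (cstar x * x)\<close>; the C*-identity returns to
  \<open>x\<close>.\<close>

lemma star_hom_norm_le:
  assumes "star_hom \<pi>" "\<pi> 1 = 1"
  shows "norm (\<pi> x) \<le> norm x"
proof -
  have "self_adjoint (\<pi> (cstar x * x))"
    by (simp add: self_adjoint_def cstar_mult cstar_cstar star_homD[OF assms(1)])
  then obtain \<mu> where "\<mu> \<in> cspectrum (\<pi> (cstar x * x))" "norm (\<pi> (cstar x * x)) \<le> cmod \<mu>"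
    using self_adjoint_spectral_point by blast
  then have "norm (\<pi> (cstar x * x)) \<le> norm (cstar x * x)"
    using star_hom_cspectrum[OF assms] cspectrum_norm_le by fastforce
  then have "norm (\<pi> x) ^ 2 \<le> norm x ^ 2"
    by (simp add: star_homD[OF assms(1)] cstar_identity)
  then show ?thesis by (rule power2_le_imp_le) simp
qed

section \<open>Subalgebras spanned by a partition of unity\<close>

lemma is_unital_cstar_subalgebraD:
  assumes "is_unital_cstar_subalgebra S"
  shows "1 \<in> S" "0 \<in> S" "x \<in> S \<Longrightarrow> y \<in> S \<Longrightarrow> x + y \<in> S" "x \<in> S \<Longrightarrow> y \<in> S \<Longrightarrow> x * y \<in> S"
    "x \<in> S \<Longrightarrow> scaleC c x \<in> S" "x \<in> S \<Longrightarrow> cstar x \<in> S" "x \<in> S \<Longrightarrow> y \<in> S \<Longrightarrow> x - y \<in> S"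
    "closed S"
proof -
  show *: "1 \<in> S" "x \<in> S \<Longrightarrow> y \<in> S \<Longrightarrow> x + y \<in> S" "x \<in> S \<Longrightarrow> y \<in> S \<Longrightarrow> x * y \<in> S"
    "x \<in> S \<Longrightarrow> scaleC c x \<in> S" "x \<in> S \<Longrightarrow> cstar x \<in> S" "closed S" for x y c
    using assms unfolding is_unital_cstar_subalgebra_def by blast+
  show "0 \<in> S" using *(4)[of 1 0] *(1) by (simp add: scaleC.zero_left)
  show "x \<in> S \<Longrightarrow> y \<in> S \<Longrightarrow> x - y \<in> S"
    using *(2)[of x "scaleC (-1) y"] *(4)[of y "-1"] by (simp add: scaleC.minus_left scaleC_one)
qed

lemma is_unital_cstar_subalgebra_cstar_generated: "is_unital_cstar_subalgebra (cstar_generated G)"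
  unfolding cstar_generated_def is_unital_cstar_subalgebra_def by (auto intro!: closed_Inter)

lemma subset_cstar_generated: "G \<subseteq> cstar_generated G"
  by (auto simp: cstar_generated_def)

lemma cstar_generated_minimal:
  "is_unital_cstar_subalgebra S \<Longrightarrow> G \<subseteq> S \<Longrightarrow> cstar_generated G \<subseteq> S"
  by (auto simp: cstar_generated_def)

lemma cstar_generated_mono: "G \<subseteq> H \<Longrightarrow> cstar_generated G \<subseteq> cstar_generated H"
  by (auto simp: cstar_generated_def)

text \<open>For nonzero \<open>x\<close> the map scales distances by \<open>norm x\<close>, so its
  range is complete like the complex plane.\<close>

lemma closed_range_scaleC: "closed (range (\<lambda>c. scaleC c (x::'a::unital_cstar_algebra)))"
proof (cases "x = 0")
  case True
  then show ?thesis by (simp add: scaleC.zero_right image_constant_conv)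
next
  case False
  have "complete (range (\<lambda>c. scaleC c x))"
    by (rule complete_isometric_image[of "norm x"])
      (use False in \<open>auto simp: norm_scaleC mult.commute scaleC.bounded_linear_left complete_UNIV\<close>)
  then show ?thesis by (rule complete_imp_closed)
qed

text \<open>For a partition of unity this is the linear span of the \<open>e i\<close>. Conditions
  on \<open>x\<close>, rather than a span, give closedness and the algebra operations
  directly.\<close>

definition diagonal :: "'i set \<Rightarrow> ('i \<Rightarrow> 'a::unital_cstar_algebra) \<Rightarrow> 'a set" where
  "diagonal I e = {x. \<forall>i\<in>I. x * e i = e i * x \<and> (\<exists>c. x * e i = scaleC c (e i))}"

text \<open>Commutation turns \<open>cstar x * e i\<close> into \<open>cstar (x * e i)\<close>,
  which secures closure under the involution. Closedness comes from preimages of the closed lines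
  through the \<open>e i\<close>.\<close>

lemma is_unital_cstar_subalgebra_diagonal:
  assumes "\<And>i. i \<in> I \<Longrightarrow> cstar (e i) = e i"
  shows "is_unital_cstar_subalgebra (diagonal I e)"
  unfolding is_unital_cstar_subalgebra_def
proof (intro conjI ballI allI)
  show "1 \<in> diagonal I e" by (auto simp: diagonal_def intro!: exI[of _ 1] scaleC_one[symmetric])
next
  fix x y assume xy: "x \<in> diagonal I e" "y \<in> diagonal I e"
  show "x + y \<in> diagonal I e"
    unfolding diagonal_def
  proof (intro CollectI ballI conjI)
    fix i assume i: "i \<in> I"
    obtain c d where cd: "x * e i = scaleC c (e i)" "y * e i = scaleC d (e i)"
        and cm: "x * e i = e i * x" "y * e i = e i * y"
      using xy i unfolding diagonal_def by blast
    show "(x + y) * e i = e i * (x + y)" using cm by (simp add: distrib_left distrib_right)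
    have "(x + y) * e i = scaleC (c + d) (e i)" by (simp add: cd distrib_right scaleC_add_left)
    then show "\<exists>c. (x + y) * e i = scaleC c (e i)" ..
  qed
  show "x * y \<in> diagonal I e"
    unfolding diagonal_def
  proof (intro CollectI ballI conjI)
    fix i assume i: "i \<in> I"
    obtain c d where cd: "x * e i = scaleC c (e i)" "y * e i = scaleC d (e i)"
        and cm: "x * e i = e i * x" "y * e i = e i * y"
      using xy i unfolding diagonal_def by blast
    show "x * y * e i = e i * (x * y)" using cm by (metis mult.assoc)
    have "x * y * e i = scaleC (d * c) (e i)" by (simp add: cd mult.assoc scaleC_mult scaleC_scaleC)
    then show "\<exists>c. x * y * e i = scaleC c (e i)" ..
  qed
next
  fix c x assume "x \<in> diagonal I e"
  then show "scaleC c x \<in> diagonal I e"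
    unfolding diagonal_def by (auto simp: scaleC_mult) (metis scaleC_scaleC)
next
  fix x assume x: "x \<in> diagonal I e"
  show "cstar x \<in> diagonal I e"
    unfolding diagonal_def
  proof (intro CollectI ballI conjI)
    fix i assume i: "i \<in> I"
    obtain c where c: "x * e i = scaleC c (e i)" and cm: "x * e i = e i * x"
      using x i unfolding diagonal_def by blast
    have 1: "cstar x * e i = cstar (e i * x)" "e i * cstar x = cstar (x * e i)"
      using assms[OF i] by (simp_all add: cstar_mult)
    show "cstar x * e i = e i * cstar x" unfolding 1 cm ..
    have "cstar x * e i = scaleC (cnj c) (e i)"
      unfolding 1 cm[symmetric] c using assms[OF i] by (simp add: cstar_scaleC)
    then show "\<exists>c. cstar x * e i = scaleC c (e i)" ..
  qed
next
  have "diagonal I e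
      = (\<Inter>i\<in>I. {x. x * e i = e i * x} \<inter> (\<lambda>x. x * e i) -` range (\<lambda>c. scaleC c (e i)))"
    unfolding diagonal_def by blast
  also have "closed \<dots>"
    by (intro closed_INT ballI closed_Int closed_Collect_eq continuous_closed_vimage
        closed_range_scaleC continuous_intros)
  finally show "closed (diagonal I e)" .
qed

lemma lincomb_in_subalgebra:
  assumes "is_unital_cstar_subalgebra S" "\<And>i. i \<in> I \<Longrightarrow> e i \<in> S"
  shows "lincomb I e c \<in> S"
  using assms(2) unfolding lincomb_def
  by (induction I rule: infinite_finite_induct) (auto intro: is_unital_cstar_subalgebraD[OF assms(1)])

lemma diagonalE:
  assumes "proj_partition I e" "x \<in> diagonal I e"
  obtains c where "x = lincomb I e c"
proof -
  have "\<forall>i\<in>I. \<exists>c. x * e i = scaleC c (e i)" using assms(2) unfolding diagonal_def by blast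
  then obtain c where "\<And>i. i \<in> I \<Longrightarrow> x * e i = scaleC (c i) (e i)" by metis
  then show thesis using eq_lincombI[OF assms(1)] that by blast
qed

lemma lincomb_in_diagonal: "proj_partition I e \<Longrightarrow> lincomb I e c \<in> diagonal I e"
  unfolding diagonal_def by (auto simp: lincomb_times_member)

lemma member_in_diagonal:
  assumes "proj_partition I e" "i \<in> I"
  shows "e i \<in> diagonal I e"
proof -
  have "lincomb I e (\<lambda>j. if j = i then 1 else 0) = (\<Sum>j\<in>I. if j = i then e i else 0)"
    unfolding lincomb_def by (intro sum.cong refl) (auto simp: scaleC_one scaleC.zero_left)
  also have "\<dots> = e i" using assms(2) proj_partitionD(1)[OF assms(1)] by simp
  finally show ?thesis using lincomb_in_diagonal[OF assms(1)] by metis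
qed

lemma subalgebra_diagonal:
  "proj_partition I e \<Longrightarrow> is_unital_cstar_subalgebra (diagonal I e)"
  by (intro is_unital_cstar_subalgebra_diagonal) (rule proj_partitionD)

lemma diagonal_subset:
  assumes "proj_partition I e" "is_unital_cstar_subalgebra S" "\<And>i. i \<in> I \<Longrightarrow> e i \<in> S"
  shows "diagonal I e \<subseteq> S"
  using assms by (auto elim!: diagonalE intro: lincomb_in_subalgebra)

lemma lincomb_eq_imp_coeff_eq:
  assumes "proj_partition I e" "lincomb I e c = lincomb I e d" "i \<in> I" "e i \<noteq> 0"
  shows "c i = d i"
  using lincomb_times_member(1)[OF assms(1,3)] assms(2,4) by (metis scaleC_right_cancel)

lemma star_hom_on_zero: "star_hom_on S \<gamma> \<Longrightarrow> 0 \<in> S \<Longrightarrow> \<gamma> 0 = 0"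
  by (auto simp: star_hom_on_def)

lemma star_hom_on_lincomb:
  assumes \<gamma>: "star_hom_on S \<gamma>" and S: "is_unital_cstar_subalgebra S" and e: "\<And>i. i \<in> I \<Longrightarrow> e i \<in> S"
  shows "\<gamma> (lincomb I e c) = lincomb I (\<lambda>i. \<gamma> (e i)) c"
  using e
proof (induction I rule: infinite_finite_induct)
  case (insert i I)
  have "\<gamma> (scaleC (c i) (e i) + lincomb I e c) = scaleC (c i) (\<gamma> (e i)) + \<gamma> (lincomb I e c)"
    using \<gamma> insert.prems lincomb_in_subalgebra[OF S, of I e c] is_unital_cstar_subalgebraD(5)[OF S]
    by (simp add: star_hom_on_def)
  then show ?case using insert by (simp add: lincomb_def)
qed (simp_all add: lincomb_def star_hom_on_zero[OF \<gamma>] is_unital_cstar_subalgebraD(2)[OF S])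

lemma proj_partition_image:
  assumes part: "proj_partition I e" and \<gamma>: "star_hom_on (diagonal I e) \<gamma>" "\<gamma> 1 = 1"
  shows "proj_partition I (\<lambda>i. \<gamma> (e i))"
proof -
  note mem = member_in_diagonal[OF part] and S = subalgebra_diagonal[OF part]
  have mult: "\<gamma> (e i) * \<gamma> (e j) = \<gamma> (e i * e j)" if "i \<in> I" "j \<in> I" for i j
    using \<gamma>(1) mem that by (simp add: star_hom_on_def)
  have star: "cstar (\<gamma> (e i)) = \<gamma> (cstar (e i))" if "i \<in> I" for i
    using \<gamma>(1) mem that by (simp add: star_hom_on_def)
  have "\<gamma> (lincomb I e (\<lambda>i. 1)) = lincomb I (\<lambda>i. \<gamma> (e i)) (\<lambda>i. 1)"
    by (rule star_hom_on_lincomb[OF \<gamma>(1) S mem])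
  then have "(\<Sum>i\<in>I. \<gamma> (e i)) = 1"
    using lincomb_1[OF part] \<gamma>(2) by (simp add: lincomb_def scaleC_one)
  then show ?thesis
    using proj_partitionD[OF part] star_hom_on_zero[OF \<gamma>(1) is_unital_cstar_subalgebraD(2)[OF S]]
    by (auto simp: proj_partition_def is_projection_def mult star)
qed

text \<open>A member with nonzero image is itself nonzero, so its coefficient is bounded by
  \<open>norm x\<close>, and the bound for combinations applies to the image partition.\<close>

lemma star_hom_on_diagonal_norm_le:
  assumes part: "proj_partition I e" and \<gamma>: "star_hom_on (diagonal I e) \<gamma>" "\<gamma> 1 = 1"
    and x: "x \<in> diagonal I e"
  shows "norm (\<gamma> x) \<le> norm x"
proof -
  obtain c where c: "x = lincomb I e c" using diagonalE[OF part x] .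
  note S = subalgebra_diagonal[OF part]
  have "norm (lincomb I (\<lambda>i. \<gamma> (e i)) c) \<le> norm x"
  proof (rule norm_lincomb_le[OF proj_partition_image[OF part \<gamma>]])
    fix i assume i: "i \<in> I" "\<gamma> (e i) \<noteq> 0"
    then have nz: "e i \<noteq> 0" using star_hom_on_zero[OF \<gamma>(1) is_unital_cstar_subalgebraD(2)[OF S]] by auto
    have "cmod (c i) * norm (e i) = norm (x * e i)"
      by (simp add: c lincomb_times_member[OF part i(1)] norm_scaleC)
    also have "\<dots> \<le> norm x * norm (e i)" by (rule norm_mult_ineq)
    finally show "cmod (c i) \<le> norm x" using nz by simp
  qed simp
  also have "lincomb I (\<lambda>i. \<gamma> (e i)) c = \<gamma> x"
    unfolding c by (rule star_hom_on_lincomb[OF \<gamma>(1) S member_in_diagonal[OF part], symmetric])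
  finally show ?thesis .
qed

text \<open>Coefficients are carried over from \<open>e\<close> to \<open>g\<close>. They are unique
  only at nonvanishing members, and \<open>zero\<close> makes the choice at the others
  immaterial.\<close>

lemma diagonal_cross_section:
  assumes hom: "star_hom \<pi>"
    and e: "proj_partition I e" and g: "proj_partition I g"
    and lift: "\<And>i. i \<in> I \<Longrightarrow> \<pi> (g i) = e i" and zero: "\<And>i. i \<in> I \<Longrightarrow> e i = 0 \<Longrightarrow> g i = 0"
  shows "\<exists>\<gamma>. unital_star_cross_section \<pi> (diagonal I e) \<gamma> \<and> (\<forall>c. \<gamma> (lincomb I e c) = lincomb I g c)"
proof -
  define \<gamma> where "\<gamma> x = lincomb I g (SOME c. x = lincomb I e c)" for x
  have eval: "\<gamma> (lincomb I e c) = lincomb I g c" for c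
  proof -
    define d where "d = (SOME d. lincomb I e c = lincomb I e d)"
    have "lincomb I e c = lincomb I e d"
      unfolding d_def by (rule someI[of "\<lambda>d. lincomb I e c = lincomb I e d"]) (rule refl)
    then have "lincomb I g d = lincomb I g c"
      using zero by (metis lincomb_cong lincomb_eq_imp_coeff_eq[OF e])
    then show ?thesis by (simp add: \<gamma>_def d_def)
  qed
  have "star_hom_on (diagonal I e) \<gamma>"
    unfolding star_hom_on_def
    by (auto elim!: diagonalE[OF e] simp: eval lincomb_mult[OF e] lincomb_mult[OF g]
        cstar_lincomb[OF e] cstar_lincomb[OF g] simp flip: lincomb_add lincomb_scaleC)
  moreover have "\<pi> (\<gamma> x) = x" if x: "x \<in> diagonal I e" for x
  proof -
    obtain c where c: "x = lincomb I e c" using diagonalE[OF e x] .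
    have "\<pi> (lincomb I g c) = (\<Sum>i\<in>I. \<pi> (scaleC (c i) (g i)))"
      unfolding lincomb_def using proj_partitionD(1)[OF e]
      by (induction I rule: finite_induct) (simp_all add: star_homD[OF hom])
    then show ?thesis by (simp add: c eval star_homD[OF hom] lift) (simp add: lincomb_def lift)
  qed
  moreover have "\<gamma> 1 = 1" using eval[of "\<lambda>i. 1"] by (simp add: lincomb_1[OF e] lincomb_1[OF g])
  ultimately show ?thesis using eval unfolding unital_star_cross_section_def by blast
qed

section \<open>Refining a partition\<close>

text \<open>Each refinement prepends one bit saying which half is meant, so all refinements share a
  single index type.\<close>

definition split_index :: "bool list set \<Rightarrow> bool list set" where
  "split_index I = Cons True ` I \<union> Cons False ` I"

definition split_family ::
    "(bool list \<Rightarrow> 'a::unital_cstar_algebra) \<Rightarrow> (bool list \<Rightarrow> 'a) \<Rightarrow> bool list \<Rightarrow> 'a" where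
  "split_family e u xs = (if hd xs then u (tl xs) else e (tl xs) - u (tl xs))"

lemma split_index_cases:
  assumes "xs \<in> split_index I"
  obtains i where "i \<in> I" "xs = True # i" | i where "i \<in> I" "xs = False # i"
  using assms by (auto simp: split_index_def)

lemma split_family_simps [simp]:
  "split_family e u (True # i) = u i" "split_family e u (False # i) = e i - u i"
  by (simp_all add: split_family_def)

lemma Cons_in_split_index [simp]: "b # i \<in> split_index I \<longleftrightarrow> i \<in> I"
  by (cases b) (auto simp: split_index_def)

lemma sum_split_index:
  fixes f :: "bool list \<Rightarrow> 'a::ab_group_add"
  assumes "finite I"
  shows "sum f (split_index I) = (\<Sum>i\<in>I. f (True # i) + f (False # i))"
  unfolding split_index_def
  by (subst sum.union_disjoint) (use assms in \<open>auto simp: sum.reindex inj_on_def sum.distrib\<close>)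

text \<open>The two halves of a member add up to it. Coefficients that ignore the newest bit thus
  embed the old combinations into the refined ones.\<close>

lemma lincomb_split:
  "finite I \<Longrightarrow> lincomb (split_index I) (split_family e u) (\<lambda>xs. c (tl xs)) = lincomb I e c"
  by (simp add: lincomb_def sum_split_index flip: scaleC_add_right)

text \<open>Each \<open>u i\<close> is absorbed by \<open>e i\<close> on both sides and so inherits
  orthogonality to the other members.\<close>

lemma proj_partition_split:
  assumes part: "proj_partition I e" and u: "\<And>i. i \<in> I \<Longrightarrow> is_projection (u i)"
    and eu: "\<And>i. i \<in> I \<Longrightarrow> e i * u i = u i"
  shows "proj_partition (split_index I) (split_family e u)"
proof -
  note D = proj_partitionD[OF part]
  have uu: "u i * u i = u i" "cstar (u i) = u i" if "i \<in> I" for i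
    using u[OF that] by (auto simp: is_projection_def)
  have ue: "u i * e i = u i" if "i \<in> I" for i
    using arg_cong[OF eu[OF that], of cstar] that by (simp add: cstar_mult uu D)
  have 1: "e i * u j = 0" "u i * e j = 0" "u i * u j = 0" if "i \<in> I" "j \<in> I" "i \<noteq> j" for i j
  proof -
    show 1: "e i * u j = 0" using D(5)[OF that] eu[OF that(2)] by (metis mult.assoc mult_zero_left)
    show "u i * e j = 0" using D(5)[OF that] ue[OF that(1)] by (metis mult.assoc mult_zero_right)
    show "u i * u j = 0" using 1 ue[OF that(1)] by (metis mult.assoc mult_zero_right)
  qed
  show ?thesis
    unfolding proj_partition_def
  proof (intro conjI ballI impI)
    show "finite (split_index I)" using D(1) by (simp add: split_index_def)
    show "sum (split_family e u) (split_index I) = 1" by (simp add: sum_split_index D(1,2))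
  next
    fix x assume "x \<in> split_index I"
    then show "is_projection (split_family e u x)"
      by (auto elim!: split_index_cases simp: is_projection_def uu D cstar_diff eu ue
          left_diff_distrib right_diff_distrib)
  next
    fix x y assume "x \<in> split_index I" "y \<in> split_index I" "x \<noteq> y"
    then show "split_family e u x * split_family e u y = 0"
      by (elim split_index_cases; cases "tl x = tl y")
        (auto simp: left_diff_distrib right_diff_distrib D eu ue uu 1)
  qed
qed

text \<open>Commutation makes \<open>e i * p\<close> a projection below \<open>e i\<close>. The
  refined span contains the old one by \<open>lincomb_split\<close>, and \<open>p\<close> as the sum
  of the \<open>True\<close> halves; conversely, both halves are built from \<open>e i\<close> and
  \<open>p\<close>.\<close>

lemma diagonal_split_eq_cstar_generated:
  assumes part: "proj_partition I e" and gen: "diagonal I e = cstar_generated G"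
    and p: "is_projection p" and comm: "\<And>i. i \<in> I \<Longrightarrow> e i * p = p * e i"
  shows "proj_partition (split_index I) (split_family e (\<lambda>i. e i * p))"
    and "diagonal (split_index I) (split_family e (\<lambda>i. e i * p)) = cstar_generated (insert p G)"
proof -
  let ?u = "\<lambda>i. e i * p"
  let ?A = "cstar_generated (insert p G)"
  note D = proj_partitionD[OF part]
  have pp: "p * p = p" "cstar p = p" using p by (auto simp: is_projection_def)
  have "is_projection (?u i)" if "i \<in> I" for i
    unfolding is_projection_def using comm[OF that] D that pp
    by (metis cstar_mult mult.assoc)
  moreover have eu: "e i * ?u i = ?u i" if "i \<in> I" for i using D(3)[OF that] by (simp flip: mult.assoc)
  ultimately show part': "proj_partition (split_index I) (split_family e ?u)"
    by (intro proj_partition_split part)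
  show "diagonal (split_index I) (split_family e ?u) = ?A"
  proof
    note A = is_unital_cstar_subalgebra_cstar_generated[of "insert p G"]
    have eA: "e i \<in> ?A" if "i \<in> I" for i
      using member_in_diagonal[OF part that] gen cstar_generated_mono[of G "insert p G"] by blast
    moreover have pA: "p \<in> ?A" using subset_cstar_generated by blast
    ultimately show "diagonal (split_index I) (split_family e ?u) \<subseteq> ?A"
      by (intro diagonal_subset[OF part' A])
        (auto elim!: split_index_cases simp: is_unital_cstar_subalgebraD(4,7)[OF A] eA pA)
    have "lincomb (split_index I) (split_family e ?u) (\<lambda>xs. if hd xs then 1 else 0) = (\<Sum>i\<in>I. e i * p)"
      by (simp add: lincomb_def sum_split_index D(1) scaleC_one scaleC.zero_left)
    also have "\<dots> = p" by (simp add: D(2) flip: sum_distrib_right)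
    finally have "p \<in> diagonal (split_index I) (split_family e ?u)"
      using lincomb_in_diagonal[OF part'] by metis
    moreover have "diagonal I e \<subseteq> diagonal (split_index I) (split_family e ?u)"
      using lincomb_split[OF D(1)] lincomb_in_diagonal[OF part'] by (metis diagonalE[OF part] subsetI)
    then have "G \<subseteq> diagonal (split_index I) (split_family e ?u)"
      using gen subset_cstar_generated by blast
    ultimately show "?A \<subseteq> diagonal (split_index I) (split_family e ?u)"
      by (intro cstar_generated_minimal subalgebra_diagonal[OF part']) auto
  qed
qed

text \<open>The lifts below \<open>\<gamma> (e i)\<close> are chosen so that they are \<open>0\<close> or \<open>\<gamma> (e i)\<close>
  whenever \<open>e i * p\<close> is \<open>0\<close> or \<open>e i\<close>: vanishing members of the refinement must have vanishing lifts.\<close>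

lemma extend_cross_section:
  fixes \<pi> :: "'b::unital_cstar_algebra \<Rightarrow> 'm::unital_cstar_algebra" and I :: "bool list set"
  assumes rr0: "real_rank_zero TYPE('b)" and hom: "star_hom \<pi>" and unital: "\<pi> 1 = 1"
    and surj: "surj \<pi>"
    and part: "proj_partition I e" and gen: "diagonal I e = cstar_generated G"
    and p: "is_projection p" and comm: "\<And>i. i \<in> I \<Longrightarrow> e i * p = p * e i"
    and \<gamma>: "unital_star_cross_section \<pi> (cstar_generated G) \<gamma>"
  shows "\<exists>\<gamma>'. unital_star_cross_section \<pi> (cstar_generated (insert p G)) \<gamma>' \<and>
    (\<forall>x\<in>cstar_generated G. \<gamma>' x = \<gamma> x)"
proof -
  let ?u = "\<lambda>i. e i * p"
  note D = proj_partitionD[OF part] and mem = member_in_diagonal[OF part]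
  have split: "proj_partition (split_index I) (split_family e ?u)"
      "diagonal (split_index I) (split_family e ?u) = cstar_generated (insert p G)"
    using diagonal_split_eq_cstar_generated[OF part gen p] comm by blast+
  have \<gamma>hom: "star_hom_on (diagonal I e) \<gamma>" and \<gamma>1: "\<gamma> 1 = 1"
    and sect: "\<And>x. x \<in> diagonal I e \<Longrightarrow> \<pi> (\<gamma> x) = x"
    using \<gamma> unfolding gen unital_star_cross_section_def by auto
  have \<gamma>0: "\<gamma> 0 = 0"
    by (rule star_hom_on_zero[OF \<gamma>hom is_unital_cstar_subalgebraD(2)[OF subalgebra_diagonal[OF part]]])
  have partB: "proj_partition I (\<lambda>i. \<gamma> (e i))" by (rule proj_partition_image[OF part \<gamma>hom \<gamma>1])
  have "\<exists>t. is_projection t \<and> \<gamma> (e i) * t = t \<and> \<pi> t = ?u i \<and> (?u i = 0 \<longrightarrow> t = 0) \<and>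
      (e i - ?u i = 0 \<longrightarrow> \<gamma> (e i) - t = 0)" if i: "i \<in> I" for i
  proof -
    have pr: "is_projection (\<gamma> (e i))" using partB i by (simp add: proj_partition_def)
    have \<pi>e: "\<pi> (\<gamma> (e i)) = e i" by (rule sect[OF mem[OF i]])
    \<comment> \<open>A vanishing \<open>e i\<close> falls under the second case, where
      \<open>\<gamma> 0 = 0\<close> makes its lift vanish as well.\<close>
    consider "?u i = 0" "e i \<noteq> 0" | "?u i = e i" | "?u i \<noteq> 0" "?u i \<noteq> e i" by metis
    then show ?thesis
    proof cases
      case 1
      then show ?thesis by (intro exI[of _ 0]) (simp add: is_projection_def star_homD[OF hom])
    next
      case 2
      then show ?thesis using pr \<pi>e \<gamma>0 by (intro exI[of _ "\<gamma> (e i)"]) (auto simp: is_projection_def)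
    next
      case 3
      have "True # i \<in> split_index I" using i by simp
      then have "is_projection (?u i)" using split(1) unfolding proj_partition_def by fastforce
      moreover have "\<pi> (\<gamma> (e i)) * ?u i = ?u i" using D(3)[OF i] by (simp add: \<pi>e flip: mult.assoc)
      ultimately show ?thesis using real_rank_zero_lift_projection[OF rr0 hom unital surj pr] 3 by auto
    qed
  qed
  then obtain t where t: "\<And>i. i \<in> I \<Longrightarrow> is_projection (t i) \<and> \<gamma> (e i) * t i = t i \<and> \<pi> (t i) = ?u i \<and>
      (?u i = 0 \<longrightarrow> t i = 0) \<and> (e i - ?u i = 0 \<longrightarrow> \<gamma> (e i) - t i = 0)"
    by metis
  let ?e = "split_family e ?u" and ?g = "split_family (\<lambda>i. \<gamma> (e i)) t"
  have partg: "proj_partition (split_index I) ?g"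
    by (rule proj_partition_split[OF partB]) (use t in auto)
  have lift: "\<pi> (?g x) = ?e x \<and> (?e x = 0 \<longrightarrow> ?g x = 0)" if "x \<in> split_index I" for x
    using that t sect mem by (elim split_index_cases) (simp_all add: star_homD[OF hom])
  obtain \<gamma>' where \<gamma>': "unital_star_cross_section \<pi> (diagonal (split_index I) ?e) \<gamma>'"
      "\<And>c. \<gamma>' (lincomb (split_index I) ?e c) = lincomb (split_index I) ?g c"
    using diagonal_cross_section[OF hom split(1) partg] lift by blast
  have "\<gamma>' x = \<gamma> x" if x: "x \<in> diagonal I e" for x
  proof -
    obtain c where c: "x = lincomb I e c" using diagonalE[OF part x] .
    \<comment> \<open>Coefficients that ignore the new bit reassemble \<open>\<gamma> (e i)\<close>
      from its halves, whichever lift \<open>t i\<close> was chosen.\<close>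
    have "\<gamma>' x = lincomb I (\<lambda>i. \<gamma> (e i)) c"
      unfolding c lincomb_split[OF D(1), of e ?u c, symmetric] \<gamma>'(2) by (rule lincomb_split[OF D(1)])
    also have "\<dots> = \<gamma> x"
      unfolding c by (rule star_hom_on_lincomb[OF \<gamma>hom subalgebra_diagonal[OF part] mem, symmetric])
    finally show ?thesis .
  qed
  with \<gamma>'(1) show ?thesis unfolding split(2) gen by blast
qed

section \<open>Passage to the limit\<close>

lemma incseq_common_member:
  fixes A :: "nat \<Rightarrow> 'a set"
  assumes "incseq A" "x \<in> (\<Union>n. A n)" "y \<in> (\<Union>n. A n)"
  obtains m where "x \<in> A m" "y \<in> A m"
proof -
  obtain i j where "x \<in> A i" "y \<in> A j" using assms(2,3) by blast
  then have "x \<in> A (max i j)" "y \<in> A (max i j)"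
    using assms(1) by (meson incseqD max.cobounded1 max.cobounded2 subsetD)+
  then show thesis using that by blast
qed

lemma is_unital_cstar_subalgebra_closure_UN:
  fixes A :: "nat \<Rightarrow> 'a::unital_cstar_algebra set"
  assumes inc: "incseq A" and A: "\<And>n. is_unital_cstar_subalgebra (A n)"
  shows "is_unital_cstar_subalgebra (closure (\<Union>n. A n))"
proof -
  let ?U = "\<Union>n. A n"
  note D = is_unital_cstar_subalgebraD[OF A]
  have U2: "x + y \<in> ?U" "x * y \<in> ?U" if xy: "x \<in> ?U" "y \<in> ?U" for x y
    using incseq_common_member[OF inc xy] D(3,4) by (metis UN_I UNIV_I)+
  have U1: "scaleC c x \<in> ?U" "cstar x \<in> ?U" if "x \<in> ?U" for x c
    using that D(5,6) by blast+
  show ?thesis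
    unfolding is_unital_cstar_subalgebra_def
  proof (intro conjI ballI allI)
    show "1 \<in> closure ?U" by (rule subsetD[OF closure_subset UN_I[where B = A, OF UNIV_I D(1)]])
  next
    fix x y assume "x \<in> closure ?U" "y \<in> closure ?U"
    then obtain s t where s: "\<And>n. s n \<in> ?U" "s \<longlonglongrightarrow> x" and t: "\<And>n. t n \<in> ?U" "t \<longlonglongrightarrow> y"
      unfolding closure_sequential by blast
    show "x + y \<in> closure ?U"
      unfolding closure_sequential using s t
      by (intro exI[of _ "\<lambda>n. s n + t n"] conjI allI U2(1) tendsto_add)
    show "x * y \<in> closure ?U"
      unfolding closure_sequential using s t
      by (intro exI[of _ "\<lambda>n. s n * t n"] conjI allI U2(2) tendsto_mult)
  next
    fix c x assume "x \<in> closure ?U"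
    then obtain s where s: "\<And>n. s n \<in> ?U" "s \<longlonglongrightarrow> x"
      unfolding closure_sequential by blast
    show "scaleC c x \<in> closure ?U"
      unfolding closure_sequential using s
      by (intro exI[of _ "\<lambda>n. scaleC c (s n)"] conjI allI U1(1) scaleC.tendsto tendsto_const)
  next
    fix x assume "x \<in> closure ?U"
    then obtain s where s: "\<And>n. s n \<in> ?U" "s \<longlonglongrightarrow> x"
      unfolding closure_sequential by blast
    show "cstar x \<in> closure ?U"
      unfolding closure_sequential using s
      by (intro exI[of _ "\<lambda>n. cstar (s n)"] conjI allI U1(2) bounded_linear.tendsto[OF bounded_linear_cstar])
  qed simp
qed

lemma star_hom_bounded_linear:
  assumes "star_hom \<pi>" "\<pi> 1 = 1"
  shows "bounded_linear \<pi>"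
proof
  fix r x
  show "\<pi> (r *\<^sub>R x) = r *\<^sub>R \<pi> x"
    using star_homD(2)[OF assms(1), of "complex_of_real r"] by (simp add: scaleC_of_real)
  show "\<exists>K. \<forall>x. norm (\<pi> x) \<le> norm x * K"
    using star_hom_norm_le[OF assms] by (intro exI[of _ 1]) simp
qed (rule star_homD[OF assms(1)])

text \<open>The sections glue to \<open>G\<close> on the union, and contractivity makes
  \<open>G\<close> uniformly continuous. Its extension to the closure inherits the algebraic
  identities along sequences, and continuity of \<open>\<pi>\<close> preserves the section
  identity.\<close>

lemma cross_section_closure_UN:
  fixes \<pi> :: "'b::unital_cstar_algebra \<Rightarrow> 'm::unital_cstar_algebra" and A :: "nat \<Rightarrow> 'm set"
  assumes hom: "star_hom \<pi>" and unital: "\<pi> 1 = 1"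
    and inc: "incseq A" and A: "\<And>n. is_unital_cstar_subalgebra (A n)"
    and \<gamma>: "\<And>n. unital_star_cross_section \<pi> (A n) (\<gamma> n)"
    and ext: "\<And>n x. x \<in> A n \<Longrightarrow> \<gamma> (Suc n) x = \<gamma> n x"
    and le: "\<And>n x. x \<in> A n \<Longrightarrow> norm (\<gamma> n x) \<le> norm x"
  shows "\<exists>\<Gamma>. unital_star_cross_section \<pi> (closure (\<Union>n. A n)) \<Gamma>"
proof -
  let ?U = "\<Union>n. A n"
  note D = is_unital_cstar_subalgebraD[OF A]
  have ext': "\<gamma> m x = \<gamma> k x" if "k \<le> m" "x \<in> A k" for k m x
    using that
  proof (induction m rule: dec_induct)
    case (step m)
    then have "x \<in> A m" using inc by (meson incseqD subsetD)
    then show ?case using step ext by simp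
  qed simp
  \<comment> \<open>The least index merely selects a value; by \<open>ext'\<close> every index whose
    algebra contains \<open>x\<close> gives the same one.\<close>
  define G where "G x = \<gamma> (LEAST n. x \<in> A n) x" for x
  have G: "G x = \<gamma> m x" if "x \<in> A m" for x m
    unfolding G_def using that by (intro ext'[symmetric]) (auto intro: Least_le LeastI)
  have \<gamma>s: "\<gamma> m (x + y) = \<gamma> m x + \<gamma> m y" "\<gamma> m (x * y) = \<gamma> m x * \<gamma> m y"
      "\<gamma> m (scaleC c x) = scaleC c (\<gamma> m x)" "\<gamma> m (cstar x) = cstar (\<gamma> m x)" "\<pi> (\<gamma> m x) = x"
    if "x \<in> A m" "y \<in> A m" for m x y c
    using \<gamma>[of m] that unfolding unital_star_cross_section_def star_hom_on_def by blast+
  have G2: "G (x + y) = G x + G y" "G (x * y) = G x * G y" "x + y \<in> ?U" "x * y \<in> ?U"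
      "norm (G x - G y) \<le> norm (x - y)"
    if xy: "x \<in> ?U" "y \<in> ?U" for x y
  proof -
    obtain m where m: "x \<in> A m" "y \<in> A m" using incseq_common_member[OF inc xy] .
    show "x + y \<in> ?U" "x * y \<in> ?U" by (rule UN_I[where B = A, OF UNIV_I D(3)[OF m]] UN_I[where B = A, OF UNIV_I D(4)[OF m]])+
    show "G (x + y) = G x + G y" "G (x * y) = G x * G y"
      using m D(3,4) by (simp_all add: G[of _ m] \<gamma>s)
    have "G x - G y = \<gamma> m (x - y)"
      using \<gamma>s(1)[of "x - y" m y] m D(7) by (simp add: G[of _ m])
    then show "norm (G x - G y) \<le> norm (x - y)" using le m D(7) by simp
  qed
  have G1: "G (scaleC c x) = scaleC c (G x)" "G (cstar x) = cstar (G x)" "\<pi> (G x) = x"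
      "scaleC c x \<in> ?U" "cstar x \<in> ?U"
    if x: "x \<in> ?U" for x c
  proof -
    obtain m where m: "x \<in> A m" using x by blast
    show "scaleC c x \<in> ?U" "cstar x \<in> ?U" by (rule UN_I[where B = A, OF UNIV_I D(5)[OF m]] UN_I[where B = A, OF UNIV_I D(6)[OF m]])+
    show "G (scaleC c x) = scaleC c (G x)" "G (cstar x) = cstar (G x)" "\<pi> (G x) = x"
      using m D(5,6) by (simp_all add: G[of _ m] \<gamma>s)
  qed
  have "uniformly_continuous_on ?U G"
    unfolding uniformly_continuous_on_def dist_norm using G2(5) by (meson order.strict_trans1)
  then obtain h where "uniformly_continuous_on (closure ?U) h" and hG: "\<And>x. x \<in> ?U \<Longrightarrow> G x = h x"
    by (rule uniformly_continuous_on_extension_on_closure) blast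
  then have cont: "continuous_on (closure ?U) h" by (simp add: uniformly_continuous_imp_continuous)
  have lim: "(\<lambda>n. G (s n)) \<longlonglongrightarrow> h x" if s: "\<And>n. s n \<in> ?U" "s \<longlonglongrightarrow> x" for s x
  proof -
    have "x \<in> closure ?U" unfolding closure_sequential using s by blast
    moreover have "\<forall>\<^sub>F n in sequentially. s n \<in> closure ?U"
      using s(1) closure_subset by (intro always_eventually) blast
    ultimately have "(\<lambda>n. h (s n)) \<longlonglongrightarrow> h x"
      using continuous_on_tendsto_compose[OF cont s(2)] by blast
    then show ?thesis using hG s(1) by simp
  qed
  have "star_hom_on (closure ?U) h"
    unfolding star_hom_on_def
  proof (intro conjI ballI allI)
    fix x y assume "x \<in> closure ?U" "y \<in> closure ?U"
    then obtain s t where s: "\<And>n. s n \<in> ?U" "s \<longlonglongrightarrow> x" and t: "\<And>n. t n \<in> ?U" "t \<longlonglongrightarrow> y"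
      unfolding closure_sequential by blast
    have "(\<lambda>n. G (s n + t n)) \<longlonglongrightarrow> h (x + y)"
      using s t by (intro lim G2(3) tendsto_add)
    moreover have "(\<lambda>n. G (s n) + G (t n)) \<longlonglongrightarrow> h x + h y"
      using s t by (intro tendsto_add lim)
    ultimately show "h (x + y) = h x + h y"
      using G2(1)[OF s(1) t(1)] LIMSEQ_unique by auto
    have "(\<lambda>n. G (s n * t n)) \<longlonglongrightarrow> h (x * y)"
      using s t by (intro lim G2(4) tendsto_mult)
    moreover have "(\<lambda>n. G (s n) * G (t n)) \<longlonglongrightarrow> h x * h y"
      using s t by (intro tendsto_mult lim)
    ultimately show "h (x * y) = h x * h y"
      using G2(2)[OF s(1) t(1)] LIMSEQ_unique by auto
  next
    fix c x assume "x \<in> closure ?U"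
    then obtain s where s: "\<And>n. s n \<in> ?U" "s \<longlonglongrightarrow> x"
      unfolding closure_sequential by blast
    have "(\<lambda>n. G (scaleC c (s n))) \<longlonglongrightarrow> h (scaleC c x)"
      using s by (intro lim G1(4) scaleC.tendsto tendsto_const)
    moreover have "(\<lambda>n. scaleC c (G (s n))) \<longlonglongrightarrow> scaleC c (h x)"
      using s by (intro scaleC.tendsto tendsto_const lim)
    ultimately show "h (scaleC c x) = scaleC c (h x)"
      using G1(1)[OF s(1)] LIMSEQ_unique by auto
  next
    fix x assume "x \<in> closure ?U"
    then obtain s where s: "\<And>n. s n \<in> ?U" "s \<longlonglongrightarrow> x"
      unfolding closure_sequential by blast
    note tendsto_cstar = bounded_linear.tendsto[OF bounded_linear_cstar]
    have "(\<lambda>n. G (cstar (s n))) \<longlonglongrightarrow> h (cstar x)"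
      using s by (intro lim G1(5) tendsto_cstar)
    moreover have "(\<lambda>n. cstar (G (s n))) \<longlonglongrightarrow> cstar (h x)"
      using s by (intro tendsto_cstar lim)
    ultimately show "h (cstar x) = cstar (h x)"
      using G1(2)[OF s(1)] LIMSEQ_unique by auto
  qed
  moreover have "\<pi> (h x) = x" if "x \<in> closure ?U" for x
  proof -
    obtain s where s: "\<And>n. s n \<in> ?U" "s \<longlonglongrightarrow> x"
      using \<open>x \<in> closure ?U\<close> unfolding closure_sequential by blast
    have "(\<lambda>n. \<pi> (G (s n))) \<longlonglongrightarrow> \<pi> (h x)"
      using s by (intro bounded_linear.tendsto[OF star_hom_bounded_linear[OF hom unital]] lim)
    then show ?thesis using G1(3)[OF s(1)] s(2) LIMSEQ_unique by auto
  qed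
  moreover have "h 1 = 1"
  proof -
    have "h 1 = \<gamma> 0 1" using hG[OF UN_I[where B = A, OF UNIV_I D(1)[of 0]]] G[OF D(1)[of 0]] by simp
    then show ?thesis using \<gamma>[of 0] by (simp add: unital_star_cross_section_def)
  qed
  ultimately show ?thesis unfolding unital_star_cross_section_def by blast
qed

section \<open>Algebras generated by commuting projections\<close>

lemma unital_star_cross_section_subset:
  "unital_star_cross_section \<pi> T \<gamma> \<Longrightarrow> S \<subseteq> T \<Longrightarrow> unital_star_cross_section \<pi> S \<gamma>"
  unfolding unital_star_cross_section_def star_hom_on_def by (simp add: subset_iff)

text \<open>The commutant of a self-adjoint element is a unital C*-subalgebra, so it contains the
  generated algebra once it contains the generators.\<close>

lemma commutes_cstar_generated:
  assumes q: "cstar q = q" and G: "\<And>x. x \<in> G \<Longrightarrow> x * q = q * x" and x: "x \<in> cstar_generated G"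
  shows "x * q = q * x"
proof -
  have "is_unital_cstar_subalgebra {x. x * q = q * x}"
    unfolding is_unital_cstar_subalgebra_def
  proof (intro conjI ballI allI)
    fix x y assume "x \<in> {x. x * q = q * x}" "y \<in> {x. x * q = q * x}"
    then have xy: "x * q = q * x" "y * q = q * y" by simp_all
    show "x + y \<in> {x. x * q = q * x}" using xy by (simp add: distrib_left distrib_right)
    have "x * y * q = x * q * y" by (simp add: mult.assoc xy(2))
    then show "x * y \<in> {x. x * q = q * x}" by (simp add: xy(1) mult.assoc)
  next
    fix x assume "x \<in> {x. x * q = q * x}"
    then have "cstar (q * x) = cstar (x * q)" by simp
    then show "cstar x \<in> {x. x * q = q * x}" by (simp add: cstar_mult q)
  next
    show "closed {x. x * q = q * x}" by (intro closed_Collect_eq continuous_intros)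
  qed (simp_all add: scaleC_mult)
  with cstar_generated_minimal[OF this] G x show ?thesis by blast
qed

text \<open>Induction from the one-member partition, which spans the scalars. Members lie in the
  algebra of the earlier projections, hence commute with \<open>p n\<close>, which permits the next
  splitting.\<close>

lemma commuting_projections_partition:
  fixes p :: "nat \<Rightarrow> 'm::unital_cstar_algebra"
  assumes proj: "\<And>i. is_projection (p i)" and comm: "\<And>i j. p i * p j = p j * p i"
  shows "\<exists>(I :: bool list set) e. proj_partition I e \<and> diagonal I e = cstar_generated (p ` {..<n})
    \<and> (\<forall>i\<in>I. e i * p n = p n * e i)"
proof -
  have commute: "\<forall>i\<in>I. e i * p n = p n * e i"
    if "proj_partition I e" "diagonal I e = cstar_generated (p ` {..<n})"
    for n and I :: "bool list set" and e
  proof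
    fix i assume "i \<in> I"
    then have "e i \<in> cstar_generated (p ` {..<n})" using member_in_diagonal[OF that(1)] that(2) by simp
    then show "e i * p n = p n * e i"
    proof (rule commutes_cstar_generated[rotated -1])
      show "cstar (p n) = p n" using proj[of n] by (simp add: is_projection_def)
    qed (auto intro: comm)
  qed
  have "\<exists>(I :: bool list set) e. proj_partition I e \<and> diagonal I e = cstar_generated (p ` {..<n})"
  proof (induction n)
    case 0
    have part: "proj_partition {[]} (\<lambda>_. 1 :: 'm)" by (simp add: proj_partition_def is_projection_def)
    have "diagonal {[]} (\<lambda>_. 1 :: 'm) = cstar_generated {}"
    proof
      show "diagonal {[]} (\<lambda>_. 1 :: 'm) \<subseteq> cstar_generated {}"
        by (rule diagonal_subset[OF part])
          (simp_all add: is_unital_cstar_subalgebra_cstar_generated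
            is_unital_cstar_subalgebraD(1)[OF is_unital_cstar_subalgebra_cstar_generated])
    qed (intro cstar_generated_minimal subalgebra_diagonal part empty_subsetI)
    with part show ?case by auto
  next
    case (Suc n)
    then obtain I :: "bool list set" and e where
      part: "proj_partition I e" and gen: "diagonal I e = cstar_generated (p ` {..<n})" by blast
    have c: "\<And>i. i \<in> I \<Longrightarrow> e i * p n = p n * e i" using commute[OF part gen] by blast
    show ?case
      using diagonal_split_eq_cstar_generated[OF part gen proj c] by (auto simp: lessThan_Suc)
  qed
  with commute show ?thesis by blast
qed

theorem theorem4p3:
  fixes \<pi> :: "'b::unital_cstar_algebra \<Rightarrow> 'm::unital_cstar_algebra"
    and p :: "nat \<Rightarrow> 'm"
  assumes rr0: "real_rank_zero TYPE('b)"
    and hom: "star_hom \<pi>"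
    and unital: "\<pi> 1 = 1"
    and surj: "surj \<pi>"
    and proj: "\<And>i. is_projection (p i)"
    and comm: "\<And>i j. p i * p j = p j * p i"
  shows "(\<exists>\<gamma>. unital_star_cross_section \<pi> (cstar_generated (range p)) \<gamma>) \<and>
         (\<forall>n\<ge>1. \<forall>\<gamma>\<^sub>n. unital_star_cross_section \<pi> (cstar_generated (p ` {..<n})) \<gamma>\<^sub>n \<longrightarrow>
            (\<exists>\<gamma>'. unital_star_cross_section \<pi> (cstar_generated (p ` {..<Suc n})) \<gamma>' \<and>
                  (\<forall>x\<in>cstar_generated (p ` {..<n}). \<gamma>' x = \<gamma>\<^sub>n x)))"
proof -
  \<comment> \<open>With numbering from 0, \<open>A n\<close> is generated by the first
    \<open>n\<close> projections, and \<open>A 0\<close> consists of the scalars.\<close>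
  define A where "A n = cstar_generated (p ` {..<n})" for n
  have A: "is_unital_cstar_subalgebra (A n)" for n
    unfolding A_def by (rule is_unital_cstar_subalgebra_cstar_generated)
  have inc: "incseq A"
    unfolding A_def by (intro monoI cstar_generated_mono image_mono) simp
  have extend: "\<exists>\<gamma>'. unital_star_cross_section \<pi> (A (Suc n)) \<gamma>' \<and> (\<forall>x\<in>A n. \<gamma>' x = \<gamma> x)"
    if \<gamma>: "unital_star_cross_section \<pi> (A n) \<gamma>" for n \<gamma>
  proof -
    obtain I :: "bool list set" and e where part: "proj_partition I e"
      and gen: "diagonal I e = cstar_generated (p ` {..<n})"
      and c: "\<And>i. i \<in> I \<Longrightarrow> e i * p n = p n * e i"
      using commuting_projections_partition[of p n] proj comm by blast
    show ?thesis
      using extend_cross_section[OF rr0 hom unital surj part gen proj c \<gamma>[unfolded A_def]]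
      by (simp add: A_def lessThan_Suc)
  qed
  have norm_le: "norm (\<gamma> x) \<le> norm x"
    if \<gamma>: "unital_star_cross_section \<pi> (A n) \<gamma>" and x: "x \<in> A n" for n \<gamma> x
  proof -
    obtain I :: "bool list set" and e where "proj_partition I e" "diagonal I e = A n"
      using commuting_projections_partition[of p n] proj comm unfolding A_def by blast
    then show ?thesis
      using star_hom_on_diagonal_norm_le \<gamma> x unfolding unital_star_cross_section_def by metis
  qed
  have "\<exists>\<gamma>. unital_star_cross_section \<pi> (A 0) \<gamma>"
  proof -
    \<comment> \<open>The unit alone is a partition in both algebras, so scalars lift to
      scalars.\<close>
    have "\<exists>\<gamma>. unital_star_cross_section \<pi> (diagonal {()} (\<lambda>_. 1)) \<gamma> \<and>
        (\<forall>c. \<gamma> (lincomb {()} (\<lambda>_. 1) c) = lincomb {()} (\<lambda>_. 1) c)"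
      by (rule diagonal_cross_section[OF hom]) (simp_all add: unital proj_partition_def is_projection_def)
    moreover have "A 0 \<subseteq> diagonal {()} (\<lambda>_. 1)"
      unfolding A_def by (intro cstar_generated_minimal is_unital_cstar_subalgebra_diagonal) simp_all
    ultimately show ?thesis using unital_star_cross_section_subset by metis
  qed
  \<comment> \<open>Dependent choice turns the one-step extensions into a coherent sequence.\<close>
  then obtain \<gamma> where \<gamma>: "\<And>n. unital_star_cross_section \<pi> (A n) (\<gamma> n)"
      "\<And>n x. x \<in> A n \<Longrightarrow> \<gamma> (Suc n) x = \<gamma> n x"
    using dependent_nat_choice[of "\<lambda>n. unital_star_cross_section \<pi> (A n)" "\<lambda>n f g. \<forall>x\<in>A n. g x = f x"]
      extend by blast
  from cross_section_closure_UN[OF hom unital inc A \<gamma> norm_le[OF \<gamma>(1)]]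
  obtain \<Gamma> where \<Gamma>: "unital_star_cross_section \<pi> (closure (\<Union>n. A n)) \<Gamma>" ..
  have "p i \<in> A (Suc i)" for i
    unfolding A_def using subset_cstar_generated by (rule subsetD) simp
  then have "range p \<subseteq> (\<Union>n. A n)" by blast
  then have "range p \<subseteq> closure (\<Union>n. A n)" using closure_subset by (rule order.trans)
  \<comment> \<open>The closure is a unital C*-subalgebra containing every \<open>p i\<close>, so
    the limit section restricts to the algebra they generate.\<close>
  then have "cstar_generated (range p) \<subseteq> closure (\<Union>n. A n)"
    by (intro cstar_generated_minimal is_unital_cstar_subalgebra_closure_UN inc A)
  with \<Gamma> have "unital_star_cross_section \<pi> (cstar_generated (range p)) \<Gamma>"
    by (rule unital_star_cross_section_subset)
  then have "\<exists>\<gamma>. unital_star_cross_section \<pi> (cstar_generated (range p)) \<gamma>" by (intro exI[of _ \<Gamma>])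
  moreover have "\<forall>n\<ge>1. \<forall>\<gamma>\<^sub>n. unital_star_cross_section \<pi> (A n) \<gamma>\<^sub>n \<longrightarrow>
      (\<exists>\<gamma>'. unital_star_cross_section \<pi> (A (Suc n)) \<gamma>' \<and> (\<forall>x\<in>A n. \<gamma>' x = \<gamma>\<^sub>n x))"
    by (intro allI impI extend)
  ultimately show ?thesis unfolding A_def ..
qed

end
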